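(* Let $ex_2(SC_3^3,n)$ denote the maximum number of edges of an $n$-vertex geometric $3$-hypergraph in the plane that does not contain three strongly crossing edges. Then $ex_2(SC_3^3,n)=\Theta(n^2)$ as $n\to\infty$; that is, there exist absolute constants $c,C>0$ and $n_0$ such that $c\,n^2\le ex_2(SC_3^3,n)\le C\,n^2$ for all $n\ge n_0$.
   Context: A geometric $3$-hypergraph in the plane is a pair $H=(V,E)$, where $V$ is a finite set of points in general position in $\mathbb{R}^2$ (no three on a line) and $E$ is a set of closed triangles, each being the convex hull of some $3$-element subset of $V$ (its vertices). $H$ is $n$-vertex if $|V|=n$. $H$ contains $k$ strongly crossing edges if there are $k$ edges in $E$ that are pairwise vertex disjoint (no two share a vertex) and such that all $k$ closed triangles have a common point. *)

theory Defs
  imports "HOL-Analysis.Analysis"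
begin

definition general_position :: "(real^2) set \<Rightarrow> bool" where
  "general_position V \<longleftrightarrow> (\<forall>A. A \<subseteq> V \<and> card A = 3 \<longrightarrow> \<not> collinear A)"

definition geometric_3_hypergraph :: "(real^2) set \<Rightarrow> (real^2) set set \<Rightarrow> bool" where
  "geometric_3_hypergraph V E \<longleftrightarrow>
     finite V \<and> general_position V \<and>
     E \<subseteq> {convex hull A | A. A \<subseteq> V \<and> card A = 3}"

text \<open>
  An edge is a closed triangle, i.e. a subset of the plane. Its vertices are recovered as its
  extreme points; \<open>triangle_vertices_convex_hull\<close> below shows that this returns the
  three-element subset of \<^term>\<open>V\<close> whose convex hull the edge is.
\<close>
definition triangle_vertices :: "(real^2) set \<Rightarrow> (real^2) set" where
  "triangle_vertices T = {x. x extreme_point_of T}"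

definition has_strongly_crossing_edges :: "nat \<Rightarrow> (real^2) set set \<Rightarrow> bool" where
  "has_strongly_crossing_edges k E \<longleftrightarrow>
     (\<exists>F. F \<subseteq> E \<and> card F = k \<and>
          pairwise (\<lambda>T T'. triangle_vertices T \<inter> triangle_vertices T' = {}) F \<and>
          \<Inter>F \<noteq> {})"

definition SC_free_sizes :: "nat \<Rightarrow> nat \<Rightarrow> nat set" where
  "SC_free_sizes k n =
     {card E | V E. geometric_3_hypergraph V E \<and> card V = n \<and>
                    \<not> has_strongly_crossing_edges k E}"

definition ex2_SC :: "nat \<Rightarrow> nat \<Rightarrow> nat" where
  "ex2_SC k n = Max (SC_free_sizes k n)"

lemma triangle_vertices_convex_hull:
  assumes "general_position V" "A \<subseteq> V" "card A = 3"
  shows "triangle_vertices (convex hull A) = A"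
proof -
  obtain a b c where A: "A = {a, b, c}" "a \<noteq> b" "a \<noteq> c" "b \<noteq> c"
    using assms(3) by (auto simp: card_3_iff)
  have "\<not> collinear {a, b, c}"
    using assms A(1) unfolding general_position_def by blast
  hence "\<not> affine_dependent {a, b, c}"
    using affine_dependent_imp_collinear_3 by blast
  thus ?thesis
    unfolding triangle_vertices_def A(1)
    by (auto simp: extreme_point_of_convex_hull_affine_independent)
qed

text \<open>The maximum defining \<^const>\<open>ex2_SC\<close> is over a finite nonempty set (for \<open>k > 0\<close>).\<close>

lemma finite_SC_free_sizes: "finite (SC_free_sizes k n)"
proof (rule finite_subset)
  show "SC_free_sizes k n \<subseteq> {..2 ^ n}"
  proof
    fix m assume "m \<in> SC_free_sizes k n"
    then obtain V E where *: "m = card E" "geometric_3_hypergraph V E" "card V = n"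
      unfolding SC_free_sizes_def by blast
    have fin: "finite V" and "E \<subseteq> (\<lambda>A. convex hull A) ` Pow V"
      using *(2) unfolding geometric_3_hypergraph_def by auto
    hence "card E \<le> card (Pow V)"
      by (meson card_image_le card_mono finite_Pow_iff finite_imageI le_trans)
    thus "m \<in> {..2 ^ n}" using * fin by (simp add: card_Pow)
  qed
qed simp

lemma general_position_exists: "\<exists>V. finite V \<and> card V = n \<and> general_position V"
proof -
  define f :: "nat \<Rightarrow> real^2" where "f i = vector [real i, (real i)\<^sup>2]" for i
  have f1: "f i $ 1 = real i" and f2: "f i $ 2 = (real i)\<^sup>2" for i
    by (simp_all add: f_def)
  have inj: "inj f"
    by (rule injI) (metis f1 of_nat_eq_iff)
  have "\<not> collinear A" if A: "A \<subseteq> f ` {..<n}" "card A = 3" for A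
  proof
    assume "collinear A"
    obtain x y z where xyz: "A = {x, y, z}" "x \<noteq> y" "x \<noteq> z" "y \<noteq> z"
      using A(2) by (auto simp: card_3_iff)
    hence "x \<in> range f" "y \<in> range f" "z \<in> range f"
      using A(1) by auto
    then obtain i j k where ijk: "x = f i" "y = f j" "z = f k"
      by (elim rangeE)
    have A': "A = {f i, f j, f k}" and d: "i \<noteq> j" "i \<noteq> k" "j \<noteq> k"
      using xyz ijk by auto
    obtain u where u: "\<And>x y. x \<in> A \<Longrightarrow> y \<in> A \<Longrightarrow> \<exists>c. x - y = c *\<^sub>R u"
      using \<open>collinear A\<close> unfolding collinear_def by blast
    obtain c where c: "f i - f j = c *\<^sub>R u" using u A' by blast
    obtain e where e: "f i - f k = e *\<^sub>R u" using u A' by blast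
    have c1: "real i - real j = c * u $ 1" and c2: "(real i)\<^sup>2 - (real j)\<^sup>2 = c * u $ 2"
      using arg_cong[OF c, of "\<lambda>v. v $ 1"] arg_cong[OF c, of "\<lambda>v. v $ 2"] by (auto simp: f1 f2)
    have e1: "real i - real k = e * u $ 1" and e2: "(real i)\<^sup>2 - (real k)\<^sup>2 = e * u $ 2"
      using arg_cong[OF e, of "\<lambda>v. v $ 1"] arg_cong[OF e, of "\<lambda>v. v $ 2"] by (auto simp: f1 f2)
    have "(real i - real j) * ((real i)\<^sup>2 - (real k)\<^sup>2)
        = (real i - real k) * ((real i)\<^sup>2 - (real j)\<^sup>2)"
      unfolding c1 c2 e1 e2 by simp
    hence "(real i - real j) * (real i - real k) * (real k - real j) = 0"
      by (simp add: algebra_simps power2_eq_square)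
    thus False using d by simp
  qed
  thus ?thesis
    using inj unfolding general_position_def
    by (intro exI[of _ "f ` {..<n}"]) (auto simp: card_image inj_on_subset)
qed

lemma SC_free_sizes_nonempty:
  assumes "k > 0"
  shows "SC_free_sizes k n \<noteq> {}"
proof -
  obtain V where "finite V" "card V = n" "general_position V"
    using general_position_exists by blast
  hence "geometric_3_hypergraph V {}" "card V = n"
    by (simp_all add: geometric_3_hypergraph_def)
  moreover have "\<not> has_strongly_crossing_edges k {}"
    using assms by (simp add: has_strongly_crossing_edges_def)
  ultimately show ?thesis
    unfolding SC_free_sizes_def by blast
qed

end

theory Submission
  imports Defs
begin

text \<open>
  For the upper bound, triples are discarded a quadratic number at a time until every pair inside a
  remaining triple extends to at least seven triples. Fix a vertex \<open>d\<close> and consider its link,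
  restricted to triangles in which \<open>d\<close> is lowest for a generic linear functional. A projective map
  sends \<open>d\<close> to vertical infinity; the link becomes a straight-line graph, and the triangle spanned by
  \<open>d\<close> and an edge becomes the region below that edge. Three strongly crossing triangles then appear as
  soon as two disjoint link edges cross below a third disjoint one (extend the two crossing edges
  by other vertices). Discarding also the apexes seen under the smallest angles from each side, no link edge
  lies entirely below a disjoint one. A straight-line graph without these two patterns has only
  linearly many edges: few edges have a longer neighbour above them at an endpoint, and each other
  edge \<open>xz\<close> lies above a crossing of a longer edge at \<open>x\<close> with a longer edge at \<open>z\<close>, which makes \<open>xz\<close>
  nearly the topmost edge there, so only boundedly many edges have their crossing between two
  consecutive vertices.
  For the lower bound, take all triangles through one vertex.
\<close>

section \<open>Counting\<close>

lemma ex_max_on: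
  fixes f :: "'a \<Rightarrow> real"
  assumes "finite S" "S \<noteq> {}"
  shows "\<exists>m\<in>S. \<forall>r\<in>S. f r \<le> f m"
proof -
  have "Max (f ` S) \<in> f ` S" using assms by (intro Max_in) auto
  then obtain m where "m \<in> S" "f m = Max (f ` S)" by auto
  thus ?thesis using assms by (intro bexI[of _ m]) auto
qed

lemma card_ge_2_other:
  assumes "2 \<le> card S"
  shows "\<exists>a\<in>S. a \<noteq> b"
proof (rule ccontr)
  assume "\<not> ?thesis"
  hence "S \<subseteq> {b}" by blast
  from card_mono[OF _ this] show False using assms by simp
qed

lemma card_le_fibers:
  assumes "finite A" "finite B" "g ` A \<subseteq> B"
    and "\<And>b. b \<in> B \<Longrightarrow> card {a \<in> A. g a = b} \<le> k"
  shows "card A \<le> k * card B"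
proof -
  have "A = (\<Union>b\<in>B. {a \<in> A. g a = b})"
    using assms(3) by auto
  hence "card A \<le> (\<Sum>b\<in>B. card {a \<in> A. g a = b})"
    using card_UN_le[OF assms(2), of "\<lambda>b. {a \<in> A. g a = b}"] by simp
  also have "\<dots> \<le> (\<Sum>b\<in>B. k)"
    using assms(4) by (intro sum_mono)
  finally show ?thesis by (simp add: mult.commute)
qed

text \<open>The least element of the set counted has all its other members above it, so its rank
  bounds their number.\<close>

lemma card_low_rank:
  fixes f :: "'a \<Rightarrow> real"
  assumes "finite S" "inj_on f S"
  shows "card {s \<in> S. card {r \<in> S. f s < f r} < k} \<le> k"
proof (rule ccontr)
  define B where "B = {s \<in> S. card {r \<in> S. f s < f r} < k}"
  assume "\<not> ?thesis"
  hence B: "card B > k" by (simp add: B_def)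
  have fB: "finite B" using assms(1) by (simp add: B_def)
  have "B \<noteq> {}" using B by auto
  then obtain s where s: "s \<in> B" "\<And>r. r \<in> B \<Longrightarrow> f s \<le> f r"
    using ex_max_on[of B "\<lambda>s. - f s"] fB by auto
  have "B - {s} \<subseteq> {r \<in> S. f s < f r}"
    using s assms(2) by (force simp: B_def inj_on_def less_le)
  hence "card (B - {s}) \<le> card {r \<in> S. f s < f r}"
    using assms(1) by (intro card_mono) auto
  moreover have "card (B - {s}) \<ge> k" using B s fB by simp
  ultimately show False using s(1) by (simp add: B_def)
qed

text \<open>Out-degrees at most \<open>k\<close> keep the average in-degree at most \<open>k\<close>
  inside every subset, so some element there is related, in either direction, to at most
  \<open>2 * k\<close> others. Picking such an element and discarding \<open>2 * k + 1\<close>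
  elements twice leaves a third choice, whence \<open>4 * k + 3\<close>.\<close>

lemma independent_triple:
  assumes "finite S" "card S \<ge> 4 * k + 3"
    and R: "\<And>a. a \<in> S \<Longrightarrow> card {b \<in> S. b \<noteq> a \<and> R a b} \<le> k"
  obtains a b c where "a \<in> S" "b \<in> S" "c \<in> S" "a \<noteq> b" "a \<noteq> c" "b \<noteq> c"
    "\<not> R a b" "\<not> R b a" "\<not> R a c" "\<not> R c a" "\<not> R b c" "\<not> R c b"
proof -
  have pick: "\<exists>a\<in>T. card {b \<in> T. b \<noteq> a \<and> (R a b \<or> R b a)} \<le> 2 * k" if T: "T \<subseteq> S" "T \<noteq> {}" for T
  proof -
    have fT: "finite T" using finite_subset[OF T(1) assms(1)] .
    have out: "card {b \<in> T. b \<noteq> a \<and> R a b} \<le> k" if "a \<in> T" for a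
    proof -
      have "card {b \<in> T. b \<noteq> a \<and> R a b} \<le> card {b \<in> S. b \<noteq> a \<and> R a b}"
        using T(1) assms(1) by (intro card_mono) auto
      thus ?thesis using R[of a] T(1) that by (meson in_mono order_trans)
    qed
    have "(\<Sum>a\<in>T. card {b \<in> T. a \<noteq> b \<and> R b a}) = (\<Sum>a\<in>T. card {b \<in> T. b \<noteq> a \<and> R a b})"
      using sum_multicount_gen[of T T "\<lambda>a b. a \<noteq> b \<and> R b a" "\<lambda>b. card {a \<in> T. a \<noteq> b \<and> R b a}"] fT
      by simp
    also have "\<dots> \<le> (\<Sum>a\<in>T. k)" using out by (intro sum_mono)
    finally have le: "(\<Sum>a\<in>T. card {b \<in> T. a \<noteq> b \<and> R b a}) \<le> (\<Sum>a\<in>T. k)" .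
    have "\<exists>a\<in>T. card {b \<in> T. a \<noteq> b \<and> R b a} \<le> k"
    proof (rule ccontr)
      assume "\<not> ?thesis"
      hence "(\<Sum>a\<in>T. k) < (\<Sum>a\<in>T. card {b \<in> T. a \<noteq> b \<and> R b a})"
        using fT T(2) by (intro sum_strict_mono) (auto simp: not_le)
      thus False using le by simp
    qed
    then obtain a where a: "a \<in> T" "card {b \<in> T. a \<noteq> b \<and> R b a} \<le> k" by blast
    have "{b \<in> T. b \<noteq> a \<and> (R a b \<or> R b a)} = {b \<in> T. b \<noteq> a \<and> R a b} \<union> {b \<in> T. a \<noteq> b \<and> R b a}"
      by auto
    hence "card {b \<in> T. b \<noteq> a \<and> (R a b \<or> R b a)} \<le> k + k"
      using card_Un_le[of "{b \<in> T. b \<noteq> a \<and> R a b}" "{b \<in> T. a \<noteq> b \<and> R b a}"] out[OF a(1)] a(2)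
      by simp
    thus ?thesis using a(1) unfolding mult_2 by blast
  qed
  have step: "\<exists>a\<in>T. \<exists>T'\<subseteq>T. card T \<le> card T' + 2 * k + 1 \<and> (\<forall>b\<in>T'. b \<noteq> a \<and> \<not> R a b \<and> \<not> R b a)"
    if T: "T \<subseteq> S" "T \<noteq> {}" for T
  proof -
    obtain a where a: "a \<in> T" "card {b \<in> T. b \<noteq> a \<and> (R a b \<or> R b a)} \<le> 2 * k"
      using pick[OF T] by blast
    have fT: "finite T" using finite_subset[OF T(1) assms(1)] .
    let ?N = "{b \<in> T. b \<noteq> a \<and> (R a b \<or> R b a)}"
    let ?T' = "T - insert a ?N"
    have "card T \<le> card (?T' \<union> insert a ?N)"
      using fT by (intro card_mono) auto
    hence "card T \<le> card ?T' + card (insert a ?N)"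
      using card_Un_le order_trans by blast
    moreover have "card (insert a ?N) \<le> 2 * k + 1"
      using a(2) fT by (simp add: card_insert_if)
    ultimately show ?thesis
      by (intro bexI[OF _ a(1)] exI[of _ ?T']) auto
  qed
  have "S \<noteq> {}" using assms(2) by auto
  then obtain a S1 where a: "a \<in> S" "S1 \<subseteq> S" "card S \<le> card S1 + 2 * k + 1"
    "\<forall>b\<in>S1. b \<noteq> a \<and> \<not> R a b \<and> \<not> R b a"
    using step[of S] by auto
  have "S1 \<noteq> {}" using a(3) assms(2) by auto
  then obtain b S2 where b: "b \<in> S1" "S2 \<subseteq> S1" "card S1 \<le> card S2 + 2 * k + 1"
    "\<forall>c\<in>S2. c \<noteq> b \<and> \<not> R b c \<and> \<not> R c b"
    using step[of S1] a(2) by auto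
  have "S2 \<noteq> {}" using a(3) b(3) assms(2) by auto
  then obtain c where "c \<in> S2" by blast
  thus thesis using that[of a b c] a b by blast
qed

section \<open>Straight-line graphs\<close>

definition slope :: "('a \<Rightarrow> real) \<Rightarrow> ('a \<Rightarrow> real) \<Rightarrow> 'a \<Rightarrow> 'a \<Rightarrow> real" where
  "slope u v x y = (v y - v x) / (u y - u x)"

definition height :: "('a \<Rightarrow> real) \<Rightarrow> ('a \<Rightarrow> real) \<Rightarrow> 'a \<Rightarrow> 'a \<Rightarrow> real \<Rightarrow> real" where
  "height u v x y t = v x + slope u v x y * (t - u x)"

lemma height_left [simp]: "height u v x y (u x) = v x"
  by (simp add: height_def)

lemma height_right: "u x \<noteq> u y \<Longrightarrow> height u v x y (u y) = v y"
  by (simp add: height_def slope_def)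

lemma height_from_right: "u x \<noteq> u y \<Longrightarrow> height u v x y t = v y + slope u v x y * (t - u y)"
  by (simp add: height_def slope_def field_simps)

lemma slope_mirror: "slope (\<lambda>p. - u p) v y x = - slope u v x y"
proof -
  have "slope (\<lambda>p. - u p) v y x = (v x - v y) / (u y - u x)"
    by (simp add: slope_def)
  also have "\<dots> = - slope u v x y"
    by (metis minus_diff_eq minus_divide_left slope_def)
  finally show ?thesis .
qed

lemma height_mirror: "u x \<noteq> u y \<Longrightarrow> height (\<lambda>p. - u p) v y x (- t) = height u v x y t"
  by (simp add: height_from_right[of u x y]) (simp add: height_def slope_mirror algebra_simps)

text \<open>The difference of two lines is affine, so it vanishes somewhere between \<open>s\<close>
  and \<open>t\<close> and keeps its sign afterwards. The last clause is what allows two crossings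
  on one edge to be compared.\<close>

lemma height_crossing:
  assumes "s \<le> t" "height u v a b s \<ge> height u v c d s" "height u v a b t \<le> height u v c d t"
  obtains r where "s \<le> r" "r \<le> t" "height u v a b r = height u v c d r"
    "\<And>r'. r \<le> r' \<Longrightarrow> r' \<le> t \<Longrightarrow> height u v a b r' \<le> height u v c d r'"
proof -
  define m where "m = slope u v a b - slope u v c d"
  define g where "g r = height u v a b r - height u v c d r" for r
  have g: "g r' = g r + m * (r' - r)" for r r'
    by (simp add: g_def m_def height_def algebra_simps)
  have gs: "g s \<ge> 0" "g t \<le> 0" using assms by (auto simp: g_def)
  show thesis
  proof (cases "m = 0")
    \<comment> \<open>Parallel lines with these signs coincide, so \<open>s\<close> itself
      serves.\<close>
    case True
    hence "g s = g t" using g[of s t] by simp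
    hence "g r = 0" for r using gs g[of s r] True by simp
    thus thesis using that[of s] assms(1) by (simp add: g_def)
  next
    case False
    have "m * (t - s) \<le> 0" using g[of t s] gs by linarith
    show thesis
    proof (cases "s = t")
      case True
      thus thesis using that[of s] assms by force
    next
      case st: False
      hence m: "m < 0" using \<open>m * (t - s) \<le> 0\<close> False assms(1)
        by (simp add: mult_le_0_iff)
      define r where "r = s - g s / m"
      have gr: "g r = 0" using g[of r s] m by (simp add: r_def)
      have "s \<le> r" using m gs by (simp add: r_def divide_nonneg_neg)
      moreover have "r \<le> t"
      proof (rule ccontr)
        assume "\<not> r \<le> t"
        hence "m * (t - r) > 0" using m by (simp add: mult_neg_neg)
        thus False using g[of t r] gr gs by simp
      qed
      moreover have "g r' \<le> 0" if "r \<le> r'" for r'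
        using g[of r' r] gr m that by (simp add: mult_le_0_iff)
      ultimately show thesis using that[of r] gr by (simp add: g_def)
    qed
  qed
qed

text \<open>A lead that is lost between \<open>s\<close> and \<open>t\<close> decreases linearly, so
  it was at least as large before \<open>s\<close>.\<close>

lemma height_order_left:
  assumes "r \<le> s" "s \<le> t" "height u v c d s \<le> height u v a b s" "height u v a b t < height u v c d t"
  shows "height u v c d r \<le> height u v a b r"
proof -
  define m where "m = slope u v a b - slope u v c d"
  have g: "height u v a b r' - height u v c d r' = height u v a b s - height u v c d s + m * (r' - s)" for r'
    by (simp add: m_def height_def algebra_simps)
  have "m * (t - s) < 0" using g[of t] assms by linarith
  hence "m < 0" using assms(2) by (simp add: mult_less_0_iff)
  hence "m * (r - s) \<ge> 0" using assms(1) by (simp add: mult_nonpos_nonpos)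
  thus ?thesis using g[of r] assms(3) by linarith
qed

lemma height_order_right:
  assumes "s \<le> t" "t \<le> r" "height u v a b s < height u v c d s" "height u v c d t \<le> height u v a b t"
  shows "height u v c d r \<le> height u v a b r"
proof -
  define m where "m = slope u v a b - slope u v c d"
  have g: "height u v a b r' - height u v c d r' = height u v a b t - height u v c d t + m * (r' - t)" for r'
    by (simp add: m_def height_def algebra_simps)
  have "m * (s - t) < 0" using g[of s] assms by linarith
  hence "m > 0" using assms(1) by (simp add: mult_less_0_iff)
  hence "m * (r - t) \<ge> 0" using assms(2) by simp
  thus ?thesis using g[of r] assms(4) by linarith
qed

section \<open>Pruning by the longer edges at each endpoint\<close>

definition longer_above :: "('a \<Rightarrow> real) \<Rightarrow> ('a \<Rightarrow> real) \<Rightarrow> ('a \<times> 'a) set \<Rightarrow> 'a \<Rightarrow> 'a \<Rightarrow> 'a set" where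
  "longer_above u v L x y = {y'. (x, y') \<in> L \<and> u y < u y' \<and> v y \<le> height u v x y' (u y)}"

text \<open>
  The map \<open>u \<mapsto> - u\<close> reflects the picture, so that every statement about the right-hand neighbours of
  a left endpoint also yields its mirror image.
\<close>

definition trim1 :: "('a \<Rightarrow> real) \<Rightarrow> ('a \<Rightarrow> real) \<Rightarrow> ('a \<times> 'a) set \<Rightarrow> ('a \<times> 'a) set" where
  "trim1 u v L = {(x, y) \<in> L. card (longer_above u v L x y) \<le> 1 \<and>
                              card (longer_above (\<lambda>p. - u p) v (L\<inverse>) y x) \<le> 1}"

text \<open>Of three longer edges at one endpoint, at most one passes weakly above the other
  endpoint, by membership in \<open>trim1\<close>. Two strictly lower ones remain, so that a
  prescribed vertex can still be avoided.\<close>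

definition trim2 :: "('a \<Rightarrow> real) \<Rightarrow> ('a \<Rightarrow> real) \<Rightarrow> ('a \<times> 'a) set \<Rightarrow> ('a \<times> 'a) set" where
  "trim2 u v L = {(x, y) \<in> trim1 u v L. 3 \<le> card {y'. (x, y') \<in> trim1 u v L \<and> u y < u y'} \<and>
                                        3 \<le> card {x'. (x', y) \<in> trim1 u v L \<and> u x' < u x}}"

lemma trim1_mirror: "trim1 (\<lambda>p. - u p) v (L\<inverse>) = (trim1 u v L)\<inverse>"
  by (auto simp: trim1_def)

lemma trim2_mirror: "trim2 (\<lambda>p. - u p) v (L\<inverse>) = (trim2 u v L)\<inverse>"
  by (auto simp: trim2_def trim1_mirror)

text \<open>The mates run below \<open>xz\<close> on their way to the crossing at abscissa
  \<open>q\<close>. In a graph satisfying \<open>no_crossing_below\<close>, an edge over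
  \<open>q\<close> that is disjoint from both mates must therefore pass strictly below that
  crossing.\<close>

definition crossing_mates ::
  "('a \<Rightarrow> real) \<Rightarrow> ('a \<Rightarrow> real) \<Rightarrow> ('a \<times> 'a) set \<Rightarrow> 'a \<Rightarrow> 'a \<Rightarrow> 'a \<Rightarrow> 'a \<Rightarrow> real \<Rightarrow> bool" where
  "crossing_mates u v L x z y w q \<longleftrightarrow> (x, y) \<in> L \<and> (w, z) \<in> L \<and> u z < u y \<and> u w < u x \<and>
     height u v x y (u z) < v z \<and> height u v w z (u x) < v x \<and>
     u x < q \<and> q < u z \<and> height u v x y q = height u v w z q"

text \<open>The triangle belonging to an edge is the region below it, so both forbidden patterns
  describe triangles. Inequalities are weak: touching counts as lying below.\<close>

locale link_graph =
  fixes u v :: "'a \<Rightarrow> real" and V :: "'a set" and L :: "('a \<times> 'a) set"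
  assumes fin: "finite V"
    and inj: "inj_on u V"
    and edge: "(x, y) \<in> L \<Longrightarrow> x \<in> V \<and> y \<in> V \<and> u x < u y"
    and no_crossing_below: "(x1, y1) \<in> L \<Longrightarrow> (x2, y2) \<in> L \<Longrightarrow> (x3, y3) \<in> L \<Longrightarrow>
      distinct [x1, y1, x2, y2, x3, y3] \<Longrightarrow>
      u x1 \<le> t \<Longrightarrow> t \<le> u y1 \<Longrightarrow> u x2 \<le> t \<Longrightarrow> t \<le> u y2 \<Longrightarrow> u x3 \<le> t \<Longrightarrow> t \<le> u y3 \<Longrightarrow>
      height u v x1 y1 t = height u v x2 y2 t \<Longrightarrow> height u v x1 y1 t \<le> height u v x3 y3 t \<Longrightarrow> False"
    and no_nested_below: "(x, y) \<in> L \<Longrightarrow> (x', y') \<in> L \<Longrightarrow> distinct [x, y, x', y'] \<Longrightarrow>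
      u x' \<le> u x \<Longrightarrow> u y \<le> u y' \<Longrightarrow> v x \<le> height u v x' y' (u x) \<Longrightarrow>
      v y \<le> height u v x' y' (u y) \<Longrightarrow> False"
begin

lemma edge_less: "(x, y) \<in> L \<Longrightarrow> u x < u y" and edge_V: "(x, y) \<in> L \<Longrightarrow> x \<in> V" "(x, y) \<in> L \<Longrightarrow> y \<in> V"
  using edge by auto

lemma finite_L [simp, intro]: "finite L"
  using fin edge by (intro finite_subset[of L "V \<times> V"]) auto

lemma height_edge_mirror:
  "(x, y) \<in> L \<Longrightarrow> height (\<lambda>p. - u p) v y x t = height u v x y (- t)"
  using height_mirror[of u x y v "- t"] edge_less[of x y] by simp

lemma mirror: "link_graph (\<lambda>p. - u p) v V (L\<inverse>)"
proof
  show "finite V" by (rule fin)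
  show "inj_on (\<lambda>p. - u p) V" using inj by (simp add: inj_on_def)
next
  fix x y assume "(x, y) \<in> L\<inverse>"
  thus "x \<in> V \<and> y \<in> V \<and> - u x < - u y" using edge[of y x] by simp
next
  fix x1 y1 x2 y2 x3 y3 and t :: real
  assume A: "(x1, y1) \<in> L\<inverse>" "(x2, y2) \<in> L\<inverse>" "(x3, y3) \<in> L\<inverse>" "distinct [x1, y1, x2, y2, x3, y3]"
    "- u x1 \<le> t" "t \<le> - u y1" "- u x2 \<le> t" "t \<le> - u y2" "- u x3 \<le> t" "t \<le> - u y3"
    "height (\<lambda>p. - u p) v x1 y1 t = height (\<lambda>p. - u p) v x2 y2 t"
    "height (\<lambda>p. - u p) v x1 y1 t \<le> height (\<lambda>p. - u p) v x3 y3 t"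
  show False
    using A by (intro no_crossing_below[of y1 x1 y2 x2 y3 x3 "- t"])
      (auto simp: height_edge_mirror)
next
  fix x y x' y'
  assume A: "(x, y) \<in> L\<inverse>" "(x', y') \<in> L\<inverse>" "distinct [x, y, x', y']"
    "- u x' \<le> - u x" "- u y \<le> - u y'" "v x \<le> height (\<lambda>p. - u p) v x' y' (- u x)"
    "v y \<le> height (\<lambda>p. - u p) v x' y' (- u y)"
  show False
    using A by (intro no_nested_below[of y x y' x']) (auto simp: height_edge_mirror)
qed

text \<open>
  If \<open>x''y\<close> did not cross the longer edge \<open>xy'\<close>, it would lie entirely below it.
\<close>

lemma cross_longer_above:
  assumes e: "(x'', y) \<in> L" and "(x, y) \<in> L" "y' \<in> longer_above u v L x y" "x'' \<noteq> x"
    and sl: "slope u v x'' y \<le> slope u v x y"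
  obtains t where "u x \<le> t" "u x'' \<le> t" "t \<le> u y" "height u v x'' y t = height u v x y' t"
    "\<And>r. t \<le> r \<Longrightarrow> r \<le> u y \<Longrightarrow> height u v x'' y r \<le> height u v x y' r"
proof -
  have f: "(x, y') \<in> L" "u y < u y'" "v y \<le> height u v x y' (u y)"
    using assms(3) by (auto simp: longer_above_def)
  have lt: "u x < u y" "u x'' < u y" using edge_less assms by auto
  \<comment> \<open>The first abscissa over which both edges run.\<close>
  define t0 where "t0 = max (u x) (u x'')"
  have start: "height u v x y' t0 \<le> height u v x'' y t0"
  proof (cases "u x'' \<le> u x")
    case True
    \<comment> \<open>Both lines pass through \<open>y\<close>, and the one of smaller slope is
      higher to the left.\<close>
    have "height u v x y (u x) \<le> height u v x'' y (u x)"
    proof -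
      have "slope u v x y * (u x - u y) \<le> slope u v x'' y * (u x - u y)"
        using lt sl by (simp add: mult_right_mono_neg)
      moreover have "height u v x y (u x) = v y + slope u v x y * (u x - u y)"
        "height u v x'' y (u x) = v y + slope u v x'' y * (u x - u y)"
        using lt by (simp_all only: height_from_right less_imp_neq not_False_eq_True)
      ultimately show ?thesis by linarith
    qed
    thus ?thesis using True by (simp add: t0_def)
  next
    case False
    hence "v x'' > height u v x y' (u x'')"
      using no_nested_below[of x'' y x y'] e f assms lt by (force simp: not_le)
    thus ?thesis using False by (simp add: t0_def)
  qed
  have t0: "t0 \<le> u y" using lt by (simp add: t0_def)
  have "height u v x'' y (u y) \<le> height u v x y' (u y)"
    using f lt by (simp add: height_right)
  then obtain t where "t0 \<le> t" "t \<le> u y" "height u v x'' y t = height u v x y' t"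
    "\<And>r. t \<le> r \<Longrightarrow> r \<le> u y \<Longrightarrow> height u v x'' y r \<le> height u v x y' r"
    using height_crossing[OF t0 start] by blast
  thus thesis using that[of t] by (auto simp: t0_def)
qed

text \<open>Among three such edges into \<open>y\<close>, the one of least slope crosses a longer
  edge at each of the other two left ends. Having two candidates in \<open>longer_above\<close> lets
  these longer edges end at different vertices, so all six endpoints are distinct.\<close>

lemma card_longer_above_ge_2:
  assumes "y \<in> V"
  shows "card {x. (x, y) \<in> L \<and> 2 \<le> card (longer_above u v L x y)} \<le> 2"
proof (rule ccontr)
  define A where "A = {x. (x, y) \<in> L \<and> 2 \<le> card (longer_above u v L x y)}"
  assume "\<not> ?thesis"
  hence card: "card A \<ge> 3" by (simp add: A_def)
  have fA: "finite A" using edge fin by (intro finite_subset[of A V]) (auto simp: A_def)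
  have "A \<noteq> {}" using card by auto
  then obtain x'' where x'': "x'' \<in> A" "\<And>x. x \<in> A \<Longrightarrow> slope u v x'' y \<le> slope u v x y"
    using ex_max_on[OF fA, of "\<lambda>x. - slope u v x y"] by auto
  have two: "card (A - {x''}) \<ge> 2" using card x''(1) fA by simp
  obtain x where "x \<in> A - {x''}" using card_ge_2_other[OF two] by blast
  moreover obtain x' where "x' \<in> A - {x''}" "x' \<noteq> x" using card_ge_2_other[OF two, of x] by blast
  ultimately have x: "x \<in> A" "x' \<in> A" "x \<noteq> x'" "x \<noteq> x''" "x' \<noteq> x''" by auto
  obtain y1 where y1: "y1 \<in> longer_above u v L x y"
    using x(1) card_ge_2_other[of "longer_above u v L x y"] by (auto simp: A_def)
  obtain y2 where y2: "y2 \<in> longer_above u v L x' y" "y2 \<noteq> y1"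
    using x(2) card_ge_2_other[of "longer_above u v L x' y" y1] by (auto simp: A_def)
  have L: "(x, y) \<in> L" "(x', y) \<in> L" "(x'', y) \<in> L" using x x'' by (auto simp: A_def)
  have f: "(x, y1) \<in> L" "(x', y2) \<in> L" "u y < u y1" "u y < u y2"
    using y1 y2 by (auto simp: longer_above_def)
  note lt = edge_less[OF L(1)] edge_less[OF L(2)] edge_less[OF L(3)]
  obtain t1 where t1: "u x \<le> t1" "u x'' \<le> t1" "t1 \<le> u y" "height u v x'' y t1 = height u v x y1 t1"
    "\<And>r. t1 \<le> r \<Longrightarrow> r \<le> u y \<Longrightarrow> height u v x'' y r \<le> height u v x y1 r"
    using cross_longer_above[OF L(3) L(1) y1 _ x''(2)[OF x(1)]] x by metis
  obtain t2 where t2: "u x' \<le> t2" "u x'' \<le> t2" "t2 \<le> u y" "height u v x'' y t2 = height u v x' y2 t2"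
    "\<And>r. t2 \<le> r \<Longrightarrow> r \<le> u y \<Longrightarrow> height u v x'' y r \<le> height u v x' y2 r"
    using cross_longer_above[OF L(3) L(2) y2(1) _ x''(2)[OF x(2)]] x by metis
  have d: "distinct [x'', y, x', y2, x, y1]" "distinct [x'', y, x, y1, x', y2]"
    using x y2 f lt by auto
  show False
  \<comment> \<open>At the later crossing, \<open>x''y\<close> already lies below the longer edge
    that it crossed first.\<close>
  proof (cases "t1 \<le> t2")
    case True
    show False
      using no_crossing_below[OF L(3) f(2) f(1) d(1), of t2] True t1(1) t1(5)[of t2] t2(1-4) f(3,4)
      by linarith
  next
    case False
    show False
      using no_crossing_below[OF L(3) f(1) f(2) d(2), of t1] False t1(1-4) t2(1) t2(5)[of t1] f(3,4)
      by linarith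
  qed
qed

lemma card_longer_above_bad: "card {(x, y) \<in> L. 2 \<le> card (longer_above u v L x y)} \<le> 2 * card V"
proof (rule card_le_fibers[where g = snd])
  show "finite {(x, y) \<in> L. 2 \<le> card (longer_above u v L x y)}"
    by (rule finite_subset[OF _ finite_L]) auto
  show "snd ` {(x, y) \<in> L. 2 \<le> card (longer_above u v L x y)} \<subseteq> V" using edge by auto
  fix y assume y: "y \<in> V"
  have "{a \<in> {(x, y) \<in> L. 2 \<le> card (longer_above u v L x y)}. snd a = y}
      = (\<lambda>x. (x, y)) ` {x. (x, y) \<in> L \<and> 2 \<le> card (longer_above u v L x y)}" by auto
  thus "card {a \<in> {(x, y) \<in> L. 2 \<le> card (longer_above u v L x y)}. snd a = y} \<le> 2"
    using card_longer_above_ge_2[OF y] by (simp add: card_image inj_on_def)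
qed (rule fin)

lemma card_trim1: "card L \<le> card (trim1 u v L) + 4 * card V"
proof -
  interpret m: link_graph "\<lambda>p. - u p" v V "L\<inverse>" by (rule mirror)
  let ?B = "{(x, y) \<in> L. 2 \<le> card (longer_above u v L x y)}"
  let ?C = "{(y, x) \<in> L\<inverse>. 2 \<le> card (longer_above (\<lambda>p. - u p) v (L\<inverse>) y x)}"
  have fin': "finite ?C" by (rule finite_subset[OF _ m.finite_L]) auto
  have "L \<subseteq> trim1 u v L \<union> ?B \<union> ?C\<inverse>"
    by (auto simp: trim1_def)
  hence "card L \<le> card (trim1 u v L \<union> ?B \<union> ?C\<inverse>)"
    using fin' by (intro card_mono) (auto simp: trim1_def intro: finite_subset[OF _ finite_L])
  also have "\<dots> \<le> card (trim1 u v L) + card ?B + card (?C\<inverse>)"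
    by (meson card_Un_le add_le_mono1 order_trans)
  also have "\<dots> \<le> card (trim1 u v L) + 2 * card V + 2 * card V"
    using card_longer_above_bad m.card_longer_above_bad by (simp add: add_mono)
  finally show ?thesis by simp
qed

lemma trim1_subset: "trim1 u v L \<subseteq> L" and trim2_subset: "trim2 u v L \<subseteq> trim1 u v L"
  by (auto simp: trim1_def trim2_def)

text \<open>At each left endpoint, only the three edges reaching furthest to the right can have
  fewer than three longer ones.\<close>

lemma card_few_longer:
  assumes M: "M \<subseteq> L"
  shows "card {(x, y) \<in> M. card {y'. (x, y') \<in> M \<and> u y < u y'} < 3} \<le> 3 * card V"
proof (rule card_le_fibers[where g = fst])
  show "finite {(x, y) \<in> M. card {y'. (x, y') \<in> M \<and> u y < u y'} < 3}"
    using M by (intro finite_subset[OF _ finite_L]) auto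
  show "fst ` {(x, y) \<in> M. card {y'. (x, y') \<in> M \<and> u y < u y'} < 3} \<subseteq> V" using edge M by auto
  fix x assume x: "x \<in> V"
  let ?S = "{y. (x, y) \<in> M}"
  have S: "finite ?S" "inj_on u ?S"
    using M edge fin inj by (auto intro!: finite_subset[of ?S V] intro: inj_on_subset)
  have "{a \<in> {(x, y) \<in> M. card {y'. (x, y') \<in> M \<and> u y < u y'} < 3}. fst a = x}
      = Pair x ` {y \<in> ?S. card {r \<in> ?S. u y < u r} < 3}" by auto
  thus "card {a \<in> {(x, y) \<in> M. card {y'. (x, y') \<in> M \<and> u y < u y'} < 3}. fst a = x} \<le> 3"
    using card_low_rank[OF S, of 3] by (simp add: card_image inj_on_def)
qed (rule fin)

lemma card_trim2: "card (trim1 u v L) \<le> card (trim2 u v L) + 6 * card V"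
proof -
  interpret m: link_graph "\<lambda>p. - u p" v V "L\<inverse>" by (rule mirror)
  let ?M = "trim1 u v L"
  let ?B = "{(x, y) \<in> ?M. card {y'. (x, y') \<in> ?M \<and> u y < u y'} < 3}"
  let ?C = "{(x, y) \<in> ?M\<inverse>. card {y'. (x, y') \<in> ?M\<inverse> \<and> - u y < - u y'} < 3}"
  have M: "?M \<subseteq> L" "?M\<inverse> \<subseteq> L\<inverse>" using trim1_subset by auto
  have fin': "finite ?M" using finite_subset[OF M(1) finite_L] .
  have "finite (?M\<inverse>)" using fin' by simp
  hence finC: "finite ?C" by (rule finite_subset[rotated]) auto
  have "?M \<subseteq> trim2 u v L \<union> ?B \<union> ?C\<inverse>"
    by (auto simp: trim2_def)
  hence "card ?M \<le> card (trim2 u v L \<union> ?B \<union> ?C\<inverse>)"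
    using fin' finC
    by (intro card_mono finite_UnI finite_subset[OF trim2_subset] finite_subset[of ?B ?M]) auto
  also have "\<dots> \<le> card (trim2 u v L) + card ?B + card (?C\<inverse>)"
    by (meson card_Un_le add_le_mono1 order_trans)
  also have "\<dots> \<le> card (trim2 u v L) + 3 * card V + 3 * card V"
    using card_few_longer[OF M(1)] m.card_few_longer[OF M(2)] by (simp add: add_mono)
  finally show ?thesis by simp
qed

section \<open>Crossings of longer edges below a pruned edge\<close>

lemma lower_longer_mates:
  assumes "(x, z) \<in> trim2 u v L"
  shows "2 \<le> card {y. (x, y) \<in> L \<and> u z < u y \<and> height u v x y (u z) < v z}"
proof -
  let ?S = "{y. (x, y) \<in> trim1 u v L \<and> u z < u y}"
  let ?T = "{y. (x, y) \<in> L \<and> u z < u y \<and> height u v x y (u z) < v z}"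
  have fT: "finite ?T" and fU: "finite (longer_above u v L x z)"
    using edge fin by (auto intro!: finite_subset[of _ V] simp: longer_above_def)
  have "?S \<subseteq> ?T \<union> longer_above u v L x z"
    using trim1_subset by (auto simp: longer_above_def)
  hence "card ?S \<le> card ?T + card (longer_above u v L x z)"
    using fT fU by (meson card_Un_le card_mono finite_UnI order_trans)
  thus ?thesis using assms by (simp add: trim2_def trim1_def)
qed

text \<open>Over \<open>x\<close> the edge \<open>xy\<close> starts above \<open>wz\<close>; over
  \<open>z\<close> it has fallen below the end of \<open>wz\<close>. Both comparisons are strict, so
  the crossing lies strictly between.\<close>

lemma crossing_matesE:
  assumes "(x, z) \<in> trim2 u v L"
  obtains y w q where "crossing_mates u v L x z y w q"
proof -
  interpret m: link_graph "\<lambda>p. - u p" v V "L\<inverse>" by (rule mirror)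
  have xz: "(x, z) \<in> L" "(z, x) \<in> trim2 (\<lambda>p. - u p) v (L\<inverse>)"
    using assms trim1_subset trim2_subset by (auto simp: trim2_mirror)
  obtain y where y: "(x, y) \<in> L" "u z < u y" "height u v x y (u z) < v z"
    using card_ge_2_other[OF lower_longer_mates[OF assms]] by blast
  obtain w where w: "(w, z) \<in> L" "u w < u x" "height (\<lambda>p. - u p) v z w (- u x) < v x"
    using card_ge_2_other[OF m.lower_longer_mates[OF xz(2)]] by auto
  have w3: "height u v w z (u x) < v x" using w(3) height_edge_mirror[OF w(1)] by simp
  note w = w(1,2) w3
  have lt: "u x < u z" "u w < u z" using edge_less xz w by auto
  have "height u v x y (u x) \<ge> height u v w z (u x)" "height u v x y (u z) \<le> height u v w z (u z)"
    using y w lt by (auto simp: height_right)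
  then obtain q where q: "u x \<le> q" "q \<le> u z" "height u v x y q = height u v w z q"
    using height_crossing[of "u x" "u z"] lt by (metis less_imp_le)
  moreover have "q \<noteq> u x" "q \<noteq> u z" using q y w lt by (auto simp: height_right)
  ultimately have "crossing_mates u v L x z y w q"
    using y w unfolding crossing_mates_def by auto
  thus thesis by (rule that)
qed

lemma crossing_mates_mirror:
  assumes "crossing_mates u v L x z y w q"
  shows "crossing_mates (\<lambda>p. - u p) v (L\<inverse>) z x w y (- q)"
  using assms by (auto simp: crossing_mates_def height_edge_mirror)

text \<open>
  The edge \<open>xz'\<close> has a longer edge \<open>w'z'\<close> below it at \<open>z'\<close>. If \<open>z'\<close> came after the crossing \<open>q\<close>, then
  \<open>xy\<close> would be crossed upwards by both \<open>wz\<close> and \<open>w'z'\<close>, and the later crossing would lie below the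
  edge crossing first.
\<close>

lemma shorter_above_before_crossing:
  assumes xz: "(x, z) \<in> L" and cm: "crossing_mates u v L x z y w q"
    and z': "(x, z') \<in> trim2 u v L" "u z' < u z" "slope u v x z \<le> slope u v x z'"
  shows "u z' < q"
proof (rule ccontr)
  assume "\<not> ?thesis"
  hence qz': "q \<le> u z'" by simp
  interpret m: link_graph "\<lambda>p. - u p" v V "L\<inverse>" by (rule mirror)
  have "(z', x) \<in> trim2 (\<lambda>p. - u p) v (L\<inverse>)" using z' by (auto simp: trim2_mirror)
  \<comment> \<open>Two lower mates are available at \<open>z'\<close>, so one of them avoids
    \<open>w\<close>.\<close>
  then obtain w' where w': "w' \<noteq> w" "(w', z') \<in> L" "u w' < u x"
    "height (\<lambda>p. - u p) v z' w' (- u x) < v x"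
    using card_ge_2_other[OF m.lower_longer_mates, of z' x w] by auto
  have w'4: "height u v w' z' (u x) < v x" using w'(4) height_edge_mirror[OF w'(2)] by simp
  note w' = w'(1-3) w'4
  have c: "(x, y) \<in> L" "(w, z) \<in> L" "u z < u y" "u w < u x" "height u v x y (u z) < v z"
    "height u v w z (u x) < v x" "u x < q" "q < u z" "height u v x y q = height u v w z q"
    using cm by (auto simp: crossing_mates_def)
  have xz': "(x, z') \<in> L" using z' trim1_subset trim2_subset by blast
  have lt: "u x < u z" "u x < u z'" "u w < u z" "u w' < u z'" using edge_less xz xz' w' c by auto
  have "height u v x y (u z) < height u v x z (u z)" using c lt by (simp add: height_right)
  hence "slope u v x y < slope u v x z" using lt by (simp add: height_def)
  \<comment> \<open>Seen from \<open>x\<close>, the slopes of \<open>xy\<close>, \<open>xz\<close>,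
    \<open>xz'\<close> do not decrease.\<close>
  hence "height u v x y (u z') \<le> height u v x z' (u z')"
    using z' lt by (simp add: height_def mult_right_mono)
  hence le: "height u v x y (u z') \<le> height u v w' z' (u z')"
    using lt by (simp add: height_right)
  have "height u v x y (u x) \<ge> height u v w' z' (u x)" using w' by simp
  then obtain q1 where q1: "u x \<le> q1" "q1 \<le> u z'" "height u v x y q1 = height u v w' z' q1"
    "\<And>r. q1 \<le> r \<Longrightarrow> r \<le> u z' \<Longrightarrow> height u v x y r \<le> height u v w' z' r"
    using height_crossing[OF less_imp_le[OF lt(2)] _ le] by blast
  have le2: "height u v x y (u z) \<le> height u v w z (u z)" using c lt by (simp add: height_right)
  have d: "distinct [x, y, w, z, w', z']" "distinct [x, y, w', z', w, z]"
    using c w' lt z' by auto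
  show False
  proof (cases "q1 \<le> q")
    case True
    thus False
      using no_crossing_below[OF c(1) c(2) w'(2) d(1), of q] q1(4)[of q] c(3,4,7,8,9) w'(3) qz' lt
      by linarith
  next
    case False
    \<comment> \<open>After \<open>q\<close> the line of \<open>wz\<close> stays above that of
      \<open>xy\<close>.\<close>
    have "height u v x y q1 \<le> height u v w z q1"
    proof -
      define g where "g s = height u v x y s - height u v w z s" for s
      have g: "g s = (slope u v x y - slope u v w z) * (s - q)" for s
        using c(9) by (simp add: g_def height_def algebra_simps)
      moreover have "g (u z) \<le> 0" using le2 by (simp add: g_def)
      ultimately have "(slope u v x y - slope u v w z) * (u z - q) \<le> 0" by metis
      hence "slope u v x y - slope u v w z \<le> 0" using c by (simp add: mult_le_0_iff)
      hence "g q1 \<le> 0" using g[of q1] False by (simp add: mult_nonpos_nonneg)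
      thus ?thesis by (simp add: g_def)
    qed
    thus False
      using no_crossing_below[OF c(1) w'(2) c(2) d(2), of q1] q1(1-3) c(3,4,7,8) w'(3) False z'(2) lt
      by linarith
  qed
qed

text \<open>A shorter edge in this set would end before \<open>q\<close>. Hence all of them are
  longer than \<open>xz\<close> and, by slope, pass above \<open>z\<close>; \<open>trim1\<close>
  leaves room for only one.\<close>

lemma card_above_at_crossing:
  assumes xz: "(x, z) \<in> trim2 u v L" and cm: "crossing_mates u v L x z y w q"
  shows "card {z'. (x, z') \<in> trim2 u v L \<and> z' \<noteq> z \<and> q \<le> u z' \<and> slope u v x z \<le> slope u v x z'} \<le> 1"
proof -
  let ?S = "{z'. (x, z') \<in> trim2 u v L \<and> z' \<noteq> z \<and> q \<le> u z' \<and> slope u v x z \<le> slope u v x z'}"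
  have sub: "trim2 u v L \<subseteq> L" using trim1_subset trim2_subset by blast
  have xzL: "(x, z) \<in> L" using xz sub by blast
  have "?S \<subseteq> longer_above u v L x z"
  proof
    fix z' assume z': "z' \<in> ?S"
    hence L: "(x, z') \<in> L" using sub by blast
    have "\<not> u z' < u z"
      using shorter_above_before_crossing[OF xzL cm, of z'] z' by fastforce
    moreover have "u z' \<noteq> u z" using inj z' edge_V[OF L] edge_V[OF xzL] by (auto simp: inj_on_def)
    moreover have "v z \<le> height u v x z' (u z)"
    proof -
      have "u x < u z" using edge_less[OF xzL] .
      hence "height u v x z (u z) \<le> height u v x z' (u z)"
        using z' unfolding height_def by (simp add: mult_right_mono)
      thus ?thesis using \<open>u x < u z\<close> by (simp add: height_right)
    qed
    ultimately show "z' \<in> longer_above u v L x z" using L by (simp add: longer_above_def)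
  qed
  moreover have "finite (longer_above u v L x z)"
    using edge fin by (auto intro!: finite_subset[of _ V] simp: longer_above_def)
  ultimately have "card ?S \<le> card (longer_above u v L x z)" by (rule card_mono[rotated])
  also have "\<dots> \<le> 1" using xz by (simp add: trim2_def trim1_def)
  finally show ?thesis .
qed

text \<open>Relative to the edge of least slope at \<open>x\<close>, every other edge at
  \<open>x\<close> is steeper and reaches past its crossing, so
  \<open>card_above_at_crossing\<close> allows one companion.\<close>

lemma card_fiber_left:
  assumes M: "M \<subseteq> trim2 u v L"
    and cm: "\<And>x z. (x, z) \<in> M \<Longrightarrow> crossing_mates u v L x z (Y (x, z)) (W (x, z)) (q (x, z))"
    and span: "\<And>x z x' z'. (x, z) \<in> M \<Longrightarrow> (x', z') \<in> M \<Longrightarrow> u x' \<le> q (x, z) \<and> q (x, z) \<le> u z'"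
  shows "card {z. (x, z) \<in> M} \<le> 2"
proof (cases "{z. (x, z) \<in> M} = {}")
  case False
  let ?S = "{z. (x, z) \<in> M}"
  have sub: "M \<subseteq> L" using M trim1_subset trim2_subset by blast
  have fS: "finite ?S" using sub edge fin by (intro finite_subset[of ?S V]) auto
  obtain z where z: "z \<in> ?S" "\<And>z'. z' \<in> ?S \<Longrightarrow> slope u v x z \<le> slope u v x z'"
    using ex_max_on[OF fS False, of "\<lambda>z. - slope u v x z"] by auto
  let ?T = "{z'. (x, z') \<in> trim2 u v L \<and> z' \<noteq> z \<and> q (x, z) \<le> u z' \<and> slope u v x z \<le> slope u v x z'}"
  have xz: "(x, z) \<in> M" using z(1) by simp
  have "finite ?T"
    using edge fin trim1_subset trim2_subset by (intro finite_subset[of ?T V]) auto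
  moreover have "?S - {z} \<subseteq> ?T"
    using z(2) M span[OF xz] by blast
  ultimately have "card (?S - {z}) \<le> card ?T" by (intro card_mono)
  also have "\<dots> \<le> 1" using card_above_at_crossing[OF _ cm[OF xz]] xz M by blast
  finally show ?thesis using z(1) fS by simp
next
  case True
  thus ?thesis by simp
qed

text \<open>At its own crossing an edge is strictly above every edge of \<open>M\<close> that avoids
  its endpoints and its mates. Among three mutually avoiding edges, sorted by crossing, the first
  and the third then cross each other below the second.\<close>

lemma card_fiber:
  assumes M: "M \<subseteq> trim2 u v L"
    and cm: "\<And>x z. (x, z) \<in> M \<Longrightarrow> crossing_mates u v L x z (Y (x, z)) (W (x, z)) (q (x, z))"
    and span: "\<And>x z x' z'. (x, z) \<in> M \<Longrightarrow> (x', z') \<in> M \<Longrightarrow> u x' \<le> q (x, z) \<and> q (x, z) \<le> u z'"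
  shows "card M \<le> 34"
proof (rule ccontr)
  assume "\<not> ?thesis"
  \<comment> \<open>The number 8 comes from four vertices with at most two edges of \<open>M\<close>
    on the relevant side of each.\<close>
  hence big: "card M \<ge> 4 * 8 + 3" by simp
  have sub: "M \<subseteq> L" using M trim1_subset trim2_subset by blast
  have fM: "finite M" using finite_subset[OF sub finite_L] .
  have degl: "card {f \<in> M. fst f = x} \<le> 2" for x
  proof -
    have "{f \<in> M. fst f = x} = Pair x ` {z. (x, z) \<in> M}" by auto
    thus ?thesis using card_fiber_left[OF M cm span, of x] by (simp add: card_image inj_on_def)
  qed
  have degr: "card {f \<in> M. snd f = z} \<le> 2" for z
  proof -
    interpret m: link_graph "\<lambda>p. - u p" v V "L\<inverse>" by (rule mirror)
    have "card {x. (z, x) \<in> M\<inverse>} \<le> 2"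
    proof (rule m.card_fiber_left[where Y = "\<lambda>(z, x). W (x, z)" and W = "\<lambda>(z, x). Y (x, z)"
          and q = "\<lambda>(z, x). - q (x, z)"])
      show "M\<inverse> \<subseteq> trim2 (\<lambda>p. - u p) v (L\<inverse>)" using M by (auto simp: trim2_mirror)
    next
      fix z x assume "(z, x) \<in> M\<inverse>"
      thus "crossing_mates (\<lambda>p. - u p) v (L\<inverse>) z x (case (z, x) of (z, x) \<Rightarrow> W (x, z))
              (case (z, x) of (z, x) \<Rightarrow> Y (x, z)) (case (z, x) of (z, x) \<Rightarrow> - q (x, z))"
        using crossing_mates_mirror[OF cm] by simp
    next
      fix z x z' x' assume "(z, x) \<in> M\<inverse>" "(z', x') \<in> M\<inverse>"
      thus "- u z' \<le> (case (z, x) of (z, x) \<Rightarrow> - q (x, z)) \<and> (case (z, x) of (z, x) \<Rightarrow> - q (x, z)) \<le> - u x'"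
        using span[of x z x' z'] by simp
    qed
    moreover have "{f \<in> M. snd f = z} = (\<lambda>x. (x, z)) ` {x. (z, x) \<in> M\<inverse>}" by auto
    ultimately show ?thesis by (simp add: card_image inj_on_def)
  qed
  \<comment> \<open>Left ends in \<open>M\<close> lie at or before every crossing and right ends at
    or after it, so no other coincidences with \<open>e\<close> and its mates can occur.\<close>
  define R where "R e f \<longleftrightarrow> fst f = fst e \<or> fst f = W e \<or> snd f = snd e \<or> snd f = Y e" for e f
  define H where "H e t = height u v (fst e) (snd e) t" for e t
  have outdeg: "card {f \<in> M. f \<noteq> e \<and> R e f} \<le> 8" if "e \<in> M" for e
  proof -
    let ?l = "\<lambda>x. {f \<in> M. fst f = x}" and ?r = "\<lambda>x. {f \<in> M. snd f = x}"
    have "card {f \<in> M. f \<noteq> e \<and> R e f} \<le> card (?l (fst e) \<union> ?l (W e) \<union> ?r (snd e) \<union> ?r (Y e))"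
      using fM by (intro card_mono) (auto simp: R_def)
    also have "\<dots> \<le> card (?l (fst e)) + card (?l (W e)) + card (?r (snd e)) + card (?r (Y e))"
      by (meson card_Un_le add_le_mono1 order_trans)
    also have "\<dots> \<le> 2 + 2 + 2 + 2" by (intro add_mono degl degr)
    finally show ?thesis by simp
  qed
  have top: "H f (q e) < H e (q e)" if e: "e \<in> M" and f: "f \<in> M" and nR: "\<not> R e f" for e f
  proof (rule ccontr)
    assume "\<not> ?thesis"
    hence le: "H e (q e) \<le> H f (q e)" by simp
    obtain x z where xz: "e = (x, z)" by (cases e)
    obtain x' z' where xz': "f = (x', z')" by (cases f)
    have c: "(x, Y e) \<in> L" "(W e, z) \<in> L" "u z < u (Y e)" "u (W e) < u x" "height u v x (Y e) (u z) < v z"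
      "u x < q e" "q e < u z" "height u v x (Y e) (q e) = height u v (W e) z (q e)"
      using cm[of x z] e by (auto simp: crossing_mates_def xz)
    have s: "u x' \<le> q e" "q e \<le> u z'" "(x', z') \<in> L"
      using span[of x z x' z'] e f xz xz' sub by auto
    have d: "distinct [x, Y e, W e, z, x', z']"
      using nR c s edge_less[OF s(3)] unfolding R_def xz xz' by auto
    have "height u v x (Y e) (u z) < height u v x z (u z)" using c by (simp add: height_right)
    hence "slope u v x (Y e) \<le> slope u v x z" using c by (simp add: height_def)
    hence "height u v x (Y e) (q e) \<le> H e (q e)"
      using mult_right_mono[of "slope u v x (Y e)" "slope u v x z" "q e - u x"] c(6)
      by (simp add: H_def xz height_def)
    hence "height u v x (Y e) (q e) \<le> height u v x' z' (q e)" using le by (simp add: H_def xz')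
    thus False
      using no_crossing_below[OF c(1) c(2) s(3) d, of "q e"] c(3,4,6,7,8) s(1,2) by linarith
  qed
  have ordered: False
    if e: "e1 \<in> M" "e2 \<in> M" "e3 \<in> M" and nR: "\<not> R e1 e2" "\<not> R e2 e1" "\<not> R e1 e3" "\<not> R e3 e1" "\<not> R e2 e3" "\<not> R e3 e2"
      and le: "q e1 \<le> q e2" "q e2 \<le> q e3" for e1 e2 e3
  proof -
    note top' = top[OF e(1,2) nR(1)] top[OF e(2,1) nR(2)] top[OF e(1,3) nR(3)] top[OF e(3,1) nR(4)]
      top[OF e(2,3) nR(5)] top[OF e(3,2) nR(6)]
    have "q e1 \<le> q e3" using le by simp
    then obtain p where p: "q e1 \<le> p" "p \<le> q e3" "H e1 p = H e3 p"
      using height_crossing[of "q e1" "q e3" u v "fst e3" "snd e3" "fst e1" "snd e1"] top'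
      unfolding H_def by (metis less_imp_le)
    \<comment> \<open>At \<open>q e2\<close> the edge \<open>e2\<close> is above both others. It
      falls below \<open>e3\<close> at \<open>q e3\<close>, hence is above \<open>e3\<close> before
      \<open>q e2\<close>; symmetrically it is above \<open>e1\<close> after
      \<open>q e2\<close>.\<close>
    have above: "H e1 p \<le> H e2 p"
    proof (cases "p \<le> q e2")
      case True
      have "H e3 p \<le> H e2 p"
        using height_order_left[OF True le(2)] top' unfolding H_def by (meson less_imp_le)
      thus ?thesis using p by simp
    next
      case False
      thus ?thesis
        using height_order_right[OF le(1), of p] top' unfolding H_def by (meson less_imp_le linear)
    qed
    have L: "(fst e, snd e) \<in> L" if "e \<in> M" for e using that sub by auto
    have sp: "u (fst f) \<le> q e" "q e \<le> u (snd f)" if "e \<in> M" "f \<in> M" for e f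
      using span[of "fst e" "snd e" "fst f" "snd f"] that by simp_all
    have lr: "fst e \<noteq> snd f" if "e \<in> M" "f \<in> M" for e f
      using sp[OF that] cm[of "fst e" "snd e"] that by (auto simp: crossing_mates_def)
    have d: "distinct [fst e1, snd e1, fst e3, snd e3, fst e2, snd e2]"
      using nR unfolding R_def by (auto simp: lr lr[symmetric] e)
    have "u (fst f) \<le> p" "p \<le> u (snd f)" if "f \<in> M" for f
      using sp[OF e(1) that] sp[OF e(3) that] p(1,2) by linarith+
    thus False
      using no_crossing_below[OF L[OF e(1)] L[OF e(3)] L[OF e(2)] d, of p] e p(3) above
      unfolding H_def by blast
  qed
  obtain a b c where abc: "a \<in> M" "b \<in> M" "c \<in> M"
    "\<not> R a b" "\<not> R b a" "\<not> R a c" "\<not> R c a" "\<not> R b c" "\<not> R c b"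
    by (rule independent_triple[OF fM big outdeg]) blast+
  consider "q a \<le> q b" "q b \<le> q c" | "q a \<le> q c" "q c \<le> q b" | "q b \<le> q a" "q a \<le> q c"
    | "q b \<le> q c" "q c \<le> q a" | "q c \<le> q a" "q a \<le> q b" | "q c \<le> q b" "q b \<le> q a"
    by linarith
  thus False using ordered[of a b c] ordered[of a c b] ordered[of b a c] ordered[of b c a]
      ordered[of c a b] ordered[of c b a] abc by cases auto
qed

text \<open>Edges are grouped by the last vertex at or before their crossing. No vertex separates
  two crossings of one group, so every edge of the group spans all of them.\<close>

lemma card_trim2_le: "card (trim2 u v L) \<le> 34 * card V"
proof -
  let ?M = "trim2 u v L"
  have sub: "?M \<subseteq> L" using trim1_subset trim2_subset by blast
  have "\<forall>e\<in>?M. \<exists>y w q. crossing_mates u v L (fst e) (snd e) y w q"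
    using crossing_matesE by (metis prod.collapse)
  then obtain Y W q where cm: "\<And>e. e \<in> ?M \<Longrightarrow> crossing_mates u v L (fst e) (snd e) (Y e) (W e) (q e)"
    by metis
  have "\<exists>p\<in>V. u p \<le> q e \<and> (\<forall>r\<in>V. u r \<le> q e \<longrightarrow> u r \<le> u p)" if e: "e \<in> ?M" for e
  proof -
    let ?S = "{r \<in> V. u r \<le> q e}"
    have "fst e \<in> ?S" using cm[OF e] edge_V[of "fst e" "snd e"] e sub by (auto simp: crossing_mates_def)
    hence S: "finite ?S" "?S \<noteq> {}" using fin by auto
    from ex_max_on[OF S, of u] show ?thesis by auto
  qed
  then obtain g where g: "\<And>e. e \<in> ?M \<Longrightarrow> g e \<in> V \<and> u (g e) \<le> q e \<and> (\<forall>r\<in>V. u r \<le> q e \<longrightarrow> u r \<le> u (g e))"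
    by metis
  show ?thesis
  proof (rule card_le_fibers[where g = g])
    show "finite ?M" using finite_subset[OF sub finite_L] .
    show "g ` ?M \<subseteq> V" using g by auto
    fix p assume "p \<in> V"
    show "card {a \<in> ?M. g a = p} \<le> 34"
    proof (rule card_fiber[where Y = Y and W = W and q = q])
      fix x z x' z'
      assume A: "(x, z) \<in> {a \<in> ?M. g a = p}" "(x', z') \<in> {a \<in> ?M. g a = p}"
      hence V: "x' \<in> V" "z' \<in> V" using sub edge by auto
      have "u x' < q (x', z')" "q (x', z') < u z'"
        using cm[of "(x', z')"] A by (auto simp: crossing_mates_def)
      thus "u x' \<le> q (x, z) \<and> q (x, z) \<le> u z'"
        using g[of "(x, z)"] g[of "(x', z')"] A V by force
    qed (use cm in auto)
  qed (rule fin)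
qed

lemma card_edges_le: "card L \<le> 44 * card V"
  using card_trim1 card_trim2 card_trim2_le by linarith

end

section \<open>Triples of points without three disjoint crossing triangles\<close>

text \<open>Each triple is charged to an ordered pair, from which it is recovered by naming its
  third point in \<open>D x y\<close>.\<close>

lemma card_triples_le:
  assumes "finite V"
    and ex: "\<And>A. A \<in> B \<Longrightarrow> \<exists>x\<in>V. \<exists>y\<in>V. \<exists>z\<in>D x y. A = {x, y, z}"
    and D: "\<And>x y. x \<in> V \<Longrightarrow> y \<in> V \<Longrightarrow> finite (D x y) \<and> card (D x y) \<le> k"
  shows "card B \<le> k * (card V)\<^sup>2"
proof -
  obtain g where g: "\<And>A. A \<in> B \<Longrightarrow> g A \<in> V \<times> V \<and> (\<exists>z\<in>D (fst (g A)) (snd (g A)). A = {fst (g A), snd (g A), z})"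
  proof -
    have "\<exists>p. p \<in> V \<times> V \<and> (\<exists>z\<in>D (fst p) (snd p). A = {fst p, snd p, z})" if "A \<in> B" for A
      using ex[OF that] by auto
    thus thesis using that by metis
  qed
  have fib: "{A \<in> B. g A = p} \<subseteq> (\<lambda>z. {fst p, snd p, z}) ` D (fst p) (snd p)" for p
  proof
    fix A assume "A \<in> {A \<in> B. g A = p}"
    thus "A \<in> (\<lambda>z. {fst p, snd p, z}) ` D (fst p) (snd p)" using g[of A] by auto
  qed
  have finD: "finite (D (fst p) (snd p))" "card (D (fst p) (snd p)) \<le> k" if "p \<in> V \<times> V" for p
    using D that by auto
  have "B \<subseteq> (\<Union>p\<in>V \<times> V. (\<lambda>z. {fst p, snd p, z}) ` D (fst p) (snd p))"
  proof
    fix A assume A: "A \<in> B"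
    show "A \<in> (\<Union>p\<in>V \<times> V. (\<lambda>z. {fst p, snd p, z}) ` D (fst p) (snd p))"
      using g[OF A] fib[of "g A"] A by (intro UN_I[of "g A"]) auto
  qed
  hence finB: "finite B"
    by (rule finite_subset) (use assms(1) finD in auto)
  have gV: "g ` B \<subseteq> V \<times> V" using g by blast
  have "card B \<le> k * card (V \<times> V)"
  proof (rule card_le_fibers[OF finB _ gV])
    fix p assume p: "p \<in> V \<times> V"
    have "card {A \<in> B. g A = p} \<le> card ((\<lambda>z. {fst p, snd p, z}) ` D (fst p) (snd p))"
      using fib finD[OF p] by (intro card_mono) auto
    also have "\<dots> \<le> k" using finD[OF p] card_image_le order_trans by blast
    finally show "card {A \<in> B. g A = p} \<le> k" .
  qed (use assms(1) in simp)
  thus ?thesis by (simp add: card_cartesian_product power2_eq_square)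
qed

section \<open>Pairs contained in many triples\<close>

definition heavy :: "'a set set \<Rightarrow> 'a \<Rightarrow> 'a \<Rightarrow> bool" where
  "heavy E x y \<longleftrightarrow> 7 \<le> card {z. {x, y, z} \<in> E}"

text \<open>Heaviness is measured in \<open>E\<close>, so extending a pair of a triple in
  \<open>core E\<close> only leads back into \<open>E\<close>. Iterating \<open>core\<close> permits
  two successive extensions.\<close>

definition core :: "'a set set \<Rightarrow> 'a set set" where
  "core E = {A \<in> E. \<forall>x\<in>A. \<forall>y\<in>A. x \<noteq> y \<longrightarrow> heavy E x y}"

lemma core_subset: "core E \<subseteq> E"
  by (auto simp: core_def)

lemma heavy_extend:
  assumes "heavy E x y" "finite F" "card F \<le> 6"
  obtains z where "{x, y, z} \<in> E" "z \<notin> F"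
proof -
  have "\<not> {z. {x, y, z} \<in> E} \<subseteq> F"
  proof
    assume "{z. {x, y, z} \<in> E} \<subseteq> F"
    from card_mono[OF assms(2) this] show False using assms(1,3) by (simp add: heavy_def)
  qed
  thus thesis using that by blast
qed

lemma card_core:
  assumes V: "finite V" and E: "\<And>A. A \<in> E \<Longrightarrow> A \<subseteq> V \<and> card A = 3"
  shows "card E \<le> card (core E) + 6 * (card V)\<^sup>2"
proof -
  \<comment> \<open>Heavy pairs get the empty set so that the bound 6 is uniform.\<close>
  define D where "D x y = (if heavy E x y then {} else {z. {x, y, z} \<in> E})" for x y
  have finE: "finite E"
    by (rule finite_subset[of E "Pow V"]) (use E V in \<open>blast, simp\<close>)
  have "card (E - core E) \<le> 6 * (card V)\<^sup>2"
  proof (rule card_triples_le[OF V])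
    fix A assume A: "A \<in> E - core E"
    then obtain x y where xy: "x \<in> A" "y \<in> A" "x \<noteq> y" "\<not> heavy E x y" by (auto simp: core_def)
    have "card (A - {x, y}) = 1" using E[of A] A xy by (simp add: card_Diff_subset)
    then obtain z where "A - {x, y} = {z}" by (auto simp: card_1_singleton_iff)
    hence Axyz: "A = {x, y, z}" using xy by auto
    have "A \<subseteq> V" using E[of A] A by simp
    hence "x \<in> V" "y \<in> V" using xy by auto
    moreover have "z \<in> D x y" using A xy(4) Axyz by (simp add: D_def)
    ultimately show "\<exists>x\<in>V. \<exists>y\<in>V. \<exists>z\<in>D x y. A = {x, y, z}"
      using Axyz by blast
  next
    fix x y
    have "{z. {x, y, z} \<in> E} \<subseteq> V" using E by blast
    hence "finite {z. {x, y, z} \<in> E}" using V finite_subset by blast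
    thus "finite (D x y) \<and> card (D x y) \<le> 6" by (auto simp: D_def heavy_def)
  qed
  moreover have "card E \<le> card (core E) + card (E - core E)"
    using card_Un_le[of "core E" "E - core E"] core_subset[of E] by (simp add: Un_absorb1)
  ultimately show ?thesis by linarith
qed

section \<open>Cotangent coordinates of an apex over a base segment\<close>

definition det2 :: "real^2 \<Rightarrow> real^2 \<Rightarrow> real^2 \<Rightarrow> real" where
  "det2 x y z = (y$1 - x$1) * (z$2 - x$2) - (y$2 - x$2) * (z$1 - x$1)"

text \<open>The cotangent of the directed angle at \<open>x\<close> from \<open>y\<close> to
  \<open>z\<close>, as inner product over cross product; \<open>det2\<close> is twice the signed
  area.\<close>

definition cot_at :: "real^2 \<Rightarrow> real^2 \<Rightarrow> real^2 \<Rightarrow> real" where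
  "cot_at x y z = ((y$1 - x$1) * (z$1 - x$1) + (y$2 - x$2) * (z$2 - x$2)) / det2 x y z"

text \<open>
  The point to the left of the ray from \<open>x\<close> through \<open>y\<close> that sees the other endpoint of \<open>xy\<close> under angles with
  cotangents \<open>a\<close> (at \<open>x\<close>) and \<open>b\<close> (at \<open>y\<close>). In these coordinates, lying in the triangle over \<open>xy\<close>
  with a given apex means having larger \<open>a\<close> and larger \<open>b\<close>.
\<close>

definition apex :: "real^2 \<Rightarrow> real^2 \<Rightarrow> real \<Rightarrow> real \<Rightarrow> real^2" where
  "apex x y a b = x + (1 / (a + b)) *\<^sub>R (a *\<^sub>R (y - x) + vector [x$2 - y$2, y$1 - x$1])"

lemma det2_swap: "det2 y x z = - det2 x y z"
  by (simp add: det2_def algebra_simps)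

lemma sum_squares_diff_pos:
  fixes x y :: "real^2"
  assumes "x \<noteq> y"
  shows "(y$1 - x$1)\<^sup>2 + (y$2 - x$2)\<^sup>2 > 0"
  using assms by (auto simp: vec_eq_iff forall_2 sum_power2_gt_zero_iff)

text \<open>The altitude from \<open>z\<close> splits the base, so the two cotangents add up to base
  over altitude. The minus sign undoes the reversed orientation at \<open>y\<close>.\<close>

lemma cot_sum:
  assumes "det2 x y z \<noteq> 0"
  shows "cot_at x y z - cot_at y x z = ((y$1 - x$1)\<^sup>2 + (y$2 - x$2)\<^sup>2) / det2 x y z"
proof -
  have "cot_at x y z - cot_at y x z
      = ((y$1 - x$1) * (z$1 - x$1) + (y$2 - x$2) * (z$2 - x$2)
         + ((x$1 - y$1) * (z$1 - y$1) + (x$2 - y$2) * (z$2 - y$2))) / det2 x y z"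
    unfolding cot_at_def det2_swap[of y x] by (simp add: add_divide_distrib)
  thus ?thesis by (simp add: power2_eq_square algebra_simps)
qed

lemma cot_sum_pos:
  assumes "det2 x y z > 0"
  shows "cot_at x y z - cot_at y x z > 0"
proof -
  have "x \<noteq> y" using assms by (auto simp: det2_def)
  thus ?thesis using cot_sum[of x y z] sum_squares_diff_pos[of x y] assms by simp
qed

text \<open>This expands \<open>z - x\<close> in the orthogonal basis of \<open>y - x\<close> and
  its quarter turn, with denominators cleared.\<close>

lemma det2_times_cot:
  assumes "det2 x y z \<noteq> 0"
  defines "D \<equiv> (y$1 - x$1)\<^sup>2 + (y$2 - x$2)\<^sup>2"
  shows "det2 x y z * (cot_at x y z * (y$1 - x$1) - (y$2 - x$2)) = D * (z$1 - x$1)"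
    and "det2 x y z * (cot_at x y z * (y$2 - x$2) + (y$1 - x$1)) = D * (z$2 - x$2)"
proof -
  have c: "det2 x y z * cot_at x y z = (y$1 - x$1) * (z$1 - x$1) + (y$2 - x$2) * (z$2 - x$2)"
    using assms by (simp add: cot_at_def)
  have "det2 x y z * (cot_at x y z * (y$1 - x$1) - (y$2 - x$2))
      = (det2 x y z * cot_at x y z) * (y$1 - x$1) - det2 x y z * (y$2 - x$2)"
    by (simp add: algebra_simps)
  also have "\<dots> = D * (z$1 - x$1)"
    unfolding c by (simp add: D_def det2_def power2_eq_square algebra_simps)
  finally show "det2 x y z * (cot_at x y z * (y$1 - x$1) - (y$2 - x$2)) = D * (z$1 - x$1)" .
  have "det2 x y z * (cot_at x y z * (y$2 - x$2) + (y$1 - x$1))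
      = (det2 x y z * cot_at x y z) * (y$2 - x$2) + det2 x y z * (y$1 - x$1)"
    by (simp add: algebra_simps)
  also have "\<dots> = D * (z$2 - x$2)"
    unfolding c by (simp add: D_def det2_def power2_eq_square algebra_simps)
  finally show "det2 x y z * (cot_at x y z * (y$2 - x$2) + (y$1 - x$1)) = D * (z$2 - x$2)" .
qed

lemma apex_cot:
  assumes "det2 x y z \<noteq> 0"
  shows "apex x y (cot_at x y z) (- cot_at y x z) = z"
proof -
  define D where "D = (y$1 - x$1)\<^sup>2 + (y$2 - x$2)\<^sup>2"
  have "x \<noteq> y" using assms by (auto simp: det2_def)
  hence "D > 0" using sum_squares_diff_pos[of x y] unfolding D_def by blast
  hence D: "D \<noteq> 0" by simp
  have s: "1 / (cot_at x y z + - cot_at y x z) = det2 x y z / D"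
    using cot_sum[OF assms] by (simp add: D_def)
  have "det2 x y z / D * (cot_at x y z * (y$1 - x$1) + (x$2 - y$2))
      = det2 x y z * (cot_at x y z * (y$1 - x$1) - (y$2 - x$2)) / D" by simp
  also have "\<dots> = z$1 - x$1"
    unfolding det2_times_cot(1)[OF assms] D_def[symmetric] using D by simp
  finally have 1: "det2 x y z / D * (cot_at x y z * (y$1 - x$1) + (x$2 - y$2)) = z$1 - x$1" .
  have "det2 x y z / D * (cot_at x y z * (y$2 - x$2) + (y$1 - x$1))
      = det2 x y z * (cot_at x y z * (y$2 - x$2) + (y$1 - x$1)) / D" by simp
  also have "\<dots> = z$2 - x$2"
    unfolding det2_times_cot(2)[OF assms] D_def[symmetric] using D by simp
  finally have 2: "det2 x y z / D * (cot_at x y z * (y$2 - x$2) + (y$1 - x$1)) = z$2 - x$2" .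
  have "apex x y (cot_at x y z) (- cot_at y x z) $ 1
      = x$1 + det2 x y z / D * (cot_at x y z * (y$1 - x$1) + (x$2 - y$2))"
    "apex x y (cot_at x y z) (- cot_at y x z) $ 2
      = x$2 + det2 x y z / D * (cot_at x y z * (y$2 - x$2) + (y$1 - x$1))"
    unfolding apex_def s by simp_all
  thus ?thesis unfolding 1 2 by (simp add: vec_eq_iff forall_2)
qed

text \<open>The vector from \<open>x\<close> to the apex, multiplied by \<open>a + b\<close>, is
  affine in \<open>a\<close> and independent of \<open>b\<close>; comparing two apexes gives
  barycentric coordinates.\<close>

lemma apex_decompose:
  assumes "a + b \<noteq> 0" "a0 + b0 \<noteq> 0"
  shows "apex x y a b = ((b - b0) / (a + b)) *\<^sub>R x + ((a - a0) / (a + b)) *\<^sub>R y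
           + ((a0 + b0) / (a + b)) *\<^sub>R apex x y a0 b0"
proof -
  have *: "X + (1 / s) * (a * (Y - X) + W)
      = (b - b0) / s * X + (a - a0) / s * Y + (s0 / s) * (X + (1 / s0) * (a0 * (Y - X) + W))"
    if s: "s = a + b" "s0 = a0 + b0" for X Y W s s0 :: real
  proof -
    have ne: "s \<noteq> 0" "s0 \<noteq> 0" using assms s by auto
    have "(s0 / s) * (X + (1 / s0) * (a0 * (Y - X) + W)) = (s0 * X + (a0 * (Y - X) + W)) / s"
      using ne by (simp add: add_divide_distrib distrib_left)
    moreover have "X + (1 / s) * (a * (Y - X) + W) = (s * X + (a * (Y - X) + W)) / s"
      using ne by (simp add: add_divide_distrib)
    moreover have "s * X + (a * (Y - X) + W)
        = (b - b0) * X + (a - a0) * Y + (s0 * X + (a0 * (Y - X) + W))"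
      by (simp add: s algebra_simps)
    ultimately show ?thesis by (simp add: add_divide_distrib)
  qed
  show ?thesis
    unfolding vec_eq_iff apex_def using *[OF refl refl] by simp
qed

lemma apex_in_triangle:
  assumes "a0 + b0 > 0" "a0 \<le> a" "b0 \<le> b"
  shows "apex x y a b \<in> convex hull {x, y, apex x y a0 b0}"
proof -
  have "apex x y a b = ((b - b0) / (a + b)) *\<^sub>R x + ((a - a0) / (a + b)) *\<^sub>R y
           + ((a0 + b0) / (a + b)) *\<^sub>R apex x y a0 b0"
    using assms by (intro apex_decompose) auto
  moreover have "(b - b0) / (a + b) + (a - a0) / (a + b) + (a0 + b0) / (a + b) = 1"
    using assms by (simp add: add_divide_distrib[symmetric])
  ultimately show ?thesis
    unfolding convex_hull_3 using assms
    by (intro CollectI exI[of _ "(b - b0) / (a + b)"] exI[of _ "(a - a0) / (a + b)"]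
        exI[of _ "(a0 + b0) / (a + b)"]) auto
qed

text \<open>Apexes with equal \<open>a\<close> lie on one ray from \<open>x\<close>, and a larger
  \<open>b\<close> means closer to \<open>x\<close>.\<close>

lemma apex_on_side_left:
  assumes "a + b0 > 0" "b0 \<le> b"
  shows "apex x y a b \<in> convex hull {x, apex x y a b0}"
proof -
  have "apex x y a b = ((b - b0) / (a + b)) *\<^sub>R x + ((a + b0) / (a + b)) *\<^sub>R apex x y a b0"
    using apex_decompose[of a b a b0 x y] assms by simp
  moreover have "(b - b0) / (a + b) + (a + b0) / (a + b) = 1"
    using assms by (simp add: add_divide_distrib[symmetric])
  ultimately show ?thesis
    unfolding convex_hull_2 using assms
    by (intro CollectI exI[of _ "(b - b0) / (a + b)"] exI[of _ "(a + b0) / (a + b)"]) auto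
qed

lemma apex_on_side_right:
  assumes "a0 + b > 0" "a0 \<le> a"
  shows "apex x y a b \<in> convex hull {y, apex x y a0 b}"
proof -
  have "apex x y a b = ((a - a0) / (a + b)) *\<^sub>R y + ((a0 + b) / (a + b)) *\<^sub>R apex x y a0 b"
    using apex_decompose[of a b a0 b x y] assms by simp
  moreover have "(a - a0) / (a + b) + (a0 + b) / (a + b) = 1"
    using assms by (simp add: add_divide_distrib[symmetric])
  ultimately show ?thesis
    unfolding convex_hull_2 using assms
    by (intro CollectI exI[of _ "(a - a0) / (a + b)"] exI[of _ "(a0 + b) / (a + b)"]) auto
qed

lemma collinear_scaled:
  fixes d :: "'a::real_vector"
  assumes "p - d = k *\<^sub>R (q - d)"
  shows "collinear {d, p, q}"
  unfolding collinear_def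
proof (intro exI[of _ "q - d"] ballI)
  fix x y assume "x \<in> {d, p, q}" "y \<in> {d, p, q}"
  then obtain a b where "x - d = a *\<^sub>R (q - d)" "y - d = b *\<^sub>R (q - d)"
    using assms by (metis diff_self empty_iff insert_iff scaleR_one scale_zero_left)
  hence "(x - d) - (y - d) = (a - b) *\<^sub>R (q - d)" by (simp only: scaleR_left_diff_distrib)
  hence "x - y = (a - b) *\<^sub>R (q - d)" by simp
  thus "\<exists>c. x - y = c *\<^sub>R (q - d)" by blast
qed

lemma det2_zero_collinear:
  assumes "det2 x y z = 0" "x \<noteq> y"
  shows "collinear {x, y, z}"
proof -
  have D: "y$1 - x$1 \<noteq> 0 \<or> y$2 - x$2 \<noteq> 0" using assms by (auto simp: vec_eq_iff forall_2)
  have h: "(y$1 - x$1) * (z$2 - x$2) = (y$2 - x$2) * (z$1 - x$1)"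
    using assms(1) by (simp add: det2_def)
  have lin: "b = a / e * c" "a = a / e * e" if "e \<noteq> 0" "e * b = c * a" for a b c e :: real
    using that by (simp_all add: field_simps)
  show ?thesis
  proof (cases "y$1 - x$1 = 0")
    case False
    have "z - x = ((z$1 - x$1) / (y$1 - x$1)) *\<^sub>R (y - x)"
      unfolding vec_eq_iff forall_2 vector_minus_component vector_scaleR_component real_scaleR_def
      using lin[OF False h] by blast
    hence "collinear {x, z, y}" by (rule collinear_scaled)
    thus ?thesis by (simp add: insert_commute)
  next
    case True
    have "z - x = ((z$2 - x$2) / (y$2 - x$2)) *\<^sub>R (y - x)"
      unfolding vec_eq_iff forall_2 vector_minus_component vector_scaleR_component real_scaleR_def
      using lin[OF _ h[symmetric]] D True by blast
    hence "collinear {x, z, y}" by (rule collinear_scaled)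
    thus ?thesis by (simp add: insert_commute)
  qed
qed

lemma cot_eq_collinear:
  assumes "det2 x y p \<noteq> 0" "det2 x y q \<noteq> 0" "cot_at x y p = cot_at x y q"
  shows "collinear {x, p, q}"
proof (rule collinear_scaled)
  define D where "D = (y$1 - x$1)\<^sup>2 + (y$2 - x$2)\<^sup>2"
  have "x \<noteq> y" using assms by (auto simp: det2_def)
  hence "D > 0" using sum_squares_diff_pos[of x y] unfolding D_def by blast
  hence D: "D \<noteq> 0" by simp
  have c: "r$1 - x$1 = det2 x y r * (cot_at x y r * (y$1 - x$1) - (y$2 - x$2)) / D"
    "r$2 - x$2 = det2 x y r * (cot_at x y r * (y$2 - x$2) + (y$1 - x$1)) / D"
    if "det2 x y r \<noteq> 0" for r
    unfolding det2_times_cot[OF that] D_def[symmetric] using D by simp_all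
  have ratio: "P = sp / sq * Q" if "P = sp * K / D" "Q = sq * K / D" "sq \<noteq> 0" for P Q K sp sq :: real
    using that by simp
  show "p - x = (det2 x y p / det2 x y q) *\<^sub>R (q - x)"
    unfolding vec_eq_iff forall_2 vector_minus_component vector_scaleR_component real_scaleR_def
    using ratio[OF c(1)[OF assms(1)] c(1)[OF assms(2), folded assms(3)] assms(2)]
      ratio[OF c(2)[OF assms(1)] c(2)[OF assms(2), folded assms(3)] assms(2)] by blast
qed

text \<open>Large cotangents mean small angles. Rank five suffices because at most four points, a
  triangle and one apex, will have to be avoided. The other side of \<open>xy\<close> is handled by
  exchanging \<open>x\<close> and \<open>y\<close>.\<close>

definition small_angle_apexes :: "(real^2) set set \<Rightarrow> real^2 \<Rightarrow> real^2 \<Rightarrow> (real^2) set" where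
  "small_angle_apexes E x y =
     (let Z = {z. {x, y, z} \<in> E \<and> det2 x y z > 0} in
       {z \<in> Z. card {r \<in> Z. cot_at x y z < cot_at x y r} < 5} \<union>
       {z \<in> Z. card {r \<in> Z. - cot_at y x z < - cot_at y x r} < 5})"

definition peeled :: "(real^2) set set \<Rightarrow> (real^2) set set" where
  "peeled E = {A \<in> core (core E). \<forall>x y z. A = {x, y, z} \<longrightarrow> z \<notin> small_angle_apexes (core (core E)) x y}"

section \<open>Triple systems without three disjoint triangles through a point\<close>

locale crossing_free =
  fixes V :: "(real^2) set" and E :: "(real^2) set set"
  assumes finV: "finite V"
    and gp: "general_position V"
    and triple: "A \<in> E \<Longrightarrow> A \<subseteq> V \<and> card A = 3"
    and no_crossing: "A \<in> E \<Longrightarrow> B \<in> E \<Longrightarrow> C \<in> E \<Longrightarrow> A \<inter> B = {} \<Longrightarrow> A \<inter> C = {} \<Longrightarrow> B \<inter> C = {} \<Longrightarrow>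
      P \<in> convex hull A \<Longrightarrow> P \<in> convex hull B \<Longrightarrow> P \<in> convex hull C \<Longrightarrow> False"
begin

lemma triple_distinct:
  assumes "{x, y, z} \<in> E"
  shows "x \<noteq> y" "x \<noteq> z" "y \<noteq> z" "x \<in> V" "y \<in> V" "z \<in> V"
proof -
  have c: "card {x, y, z} = 3" and V: "{x, y, z} \<subseteq> V" using triple[OF assms] by simp_all
  show "x \<in> V" "y \<in> V" "z \<in> V" using V by simp_all
  show "x \<noteq> y" "x \<noteq> z" "y \<noteq> z"
    using c by (cases "x = y"; cases "x = z"; cases "y = z"; simp add: card_insert_if)+
qed

lemma not_collinear:
  assumes "x \<in> V" "y \<in> V" "z \<in> V" "x \<noteq> y" "x \<noteq> z" "y \<noteq> z"
  shows "\<not> collinear {x, y, z}"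
proof -
  have "card {x, y, z} = 3" using assms by simp
  moreover have "{x, y, z} \<subseteq> V" using assms by simp
  ultimately show ?thesis using gp[unfolded general_position_def, rule_format, of "{x, y, z}"] by simp
qed

lemma det2_nonzero:
  assumes "x \<in> V" "y \<in> V" "z \<in> V" "x \<noteq> y" "x \<noteq> z" "y \<noteq> z"
  shows "det2 x y z \<noteq> 0"
  using det2_zero_collinear[of x y z] not_collinear[OF assms] assms(4) by blast

lemma finite_apexes: "finite {z. {x, y, z} \<in> E}"
proof -
  have "{z. {x, y, z} \<in> E} \<subseteq> V" using triple by blast
  thus ?thesis using finV finite_subset by blast
qed

text \<open>The crossing pairs are completed to disjoint triples one after the other. The first new
  vertex avoids five points and the second six, which explains the threshold seven in
  \<open>heavy\<close>.\<close>

lemma crossing_pairs_avoid: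
  assumes h: "heavy E x1 y1" "heavy E x2 y2" and C: "C \<in> E"
    and d: "distinct [x1, y1, x2, y2]" "x1 \<notin> C" "y1 \<notin> C" "x2 \<notin> C" "y2 \<notin> C"
    and P: "P \<in> convex hull {x1, y1}" "P \<in> convex hull {x2, y2}" "P \<in> convex hull C"
  shows False
proof -
  have C3: "finite C" "card C = 3" using triple[OF C] by (auto intro: card_ge_0_finite)
  have "card ({x2, y2} \<union> C) \<le> 6" "finite ({x2, y2} \<union> C)"
    using card_Un_le[of "{x2, y2}" C] C3 by (auto simp: card_insert_if split: if_splits)
  then obtain z1 where z1: "{x1, y1, z1} \<in> E" "z1 \<notin> {x2, y2} \<union> C"
    using heavy_extend[OF h(1)] by metis
  have "card {x1, y1, z1} = 3" using triple[OF z1(1)] by simp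
  hence "card ({x1, y1, z1} \<union> C) \<le> 6" "finite ({x1, y1, z1} \<union> C)"
    using card_Un_le[of "{x1, y1, z1}" C] C3 by auto
  then obtain z2 where z2: "{x2, y2, z2} \<in> E" "z2 \<notin> {x1, y1, z1} \<union> C"
    using heavy_extend[OF h(2)] by metis
  have "P \<in> convex hull {x1, y1, z1}" "P \<in> convex hull {x2, y2, z2}"
    using P hull_mono[of "{x1, y1}" "{x1, y1, z1}"] hull_mono[of "{x2, y2}" "{x2, y2, z2}"] by blast+
  moreover have "{x1, y1, z1} \<inter> {x2, y2, z2} = {}" "{x1, y1, z1} \<inter> C = {}" "{x2, y2, z2} \<inter> C = {}"
    using z1(2) z2(2) d by auto
  ultimately show False using no_crossing[OF z1(1) z2(1) C] P(3) by blast
qed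

lemma core_sub: "core E \<subseteq> E" "core (core E) \<subseteq> E" "core (core E) \<subseteq> core E" "peeled E \<subseteq> core (core E)"
proof -
  show "core E \<subseteq> E" "core (core E) \<subseteq> core E" by (rule core_subset)+
  thus "core (core E) \<subseteq> E" by (rule order_trans[rotated])
  show "peeled E \<subseteq> core (core E)" by (auto simp: peeled_def)
qed

lemma heavy_core: "{x, y, z} \<in> core E' \<Longrightarrow> x \<noteq> y \<Longrightarrow> heavy E' x y"
  by (simp add: core_def)

text \<open>General position makes both cotangents injective on the apexes, so each ranking
  contributes at most five points.\<close>

lemma small_angle_apexes_bound:
  "finite (small_angle_apexes (core (core E)) x y) \<and> card (small_angle_apexes (core (core E)) x y) \<le> 10"
proof -
  define Z where "Z = {z. {x, y, z} \<in> core (core E) \<and> det2 x y z > 0}"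
  have ZE: "{x, y, z} \<in> E" "det2 x y z > 0" if "z \<in> Z" for z
    using that core_sub by (auto simp: Z_def)
  have fZ: "finite Z"
    by (rule finite_subset[OF _ finite_apexes[of x y]]) (use ZE in auto)
  have eq: "z = r" if "z \<in> Z" "r \<in> Z" "cot_at x y z = cot_at x y r" for z r
  proof (rule ccontr)
    assume "z \<noteq> r"
    thus False
      using cot_eq_collinear[of x y z r] ZE[OF that(1)] ZE[OF that(2)] that(3)
        triple_distinct[OF ZE(1)[OF that(1)]] triple_distinct[OF ZE(1)[OF that(2)]] not_collinear[of x z r]
      by auto
  qed
  have eq': "z = r" if "z \<in> Z" "r \<in> Z" "cot_at y x z = cot_at y x r" for z r
  proof (rule ccontr)
    assume "z \<noteq> r"
    thus False
      using cot_eq_collinear[of y x z r] ZE[OF that(1)] ZE[OF that(2)] that(3) det2_swap[of y x]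
        triple_distinct[OF ZE(1)[OF that(1)]] triple_distinct[OF ZE(1)[OF that(2)]] not_collinear[of y z r]
      by auto
  qed
  have "inj_on (cot_at x y) Z" using eq by (auto simp: inj_on_def)
  moreover have "inj_on (\<lambda>z. - cot_at y x z) Z" using eq' by (auto simp: inj_on_def)
  ultimately have "card {z \<in> Z. card {r \<in> Z. cot_at x y z < cot_at x y r} < 5} \<le> 5"
    "card {z \<in> Z. card {r \<in> Z. - cot_at y x z < - cot_at y x r} < 5} \<le> 5"
    using card_low_rank[OF fZ, of "cot_at x y" 5] card_low_rank[OF fZ, of "\<lambda>z. - cot_at y x z" 5]
    by blast+
  hence "card ({z \<in> Z. card {r \<in> Z. cot_at x y z < cot_at x y r} < 5} \<union>
      {z \<in> Z. card {r \<in> Z. - cot_at y x z < - cot_at y x r} < 5}) \<le> 10"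
    by (intro order_trans[OF card_Un_le]) simp
  thus ?thesis using fZ unfolding small_angle_apexes_def Let_def Z_def[symmetric] by simp
qed

lemma card_peeled: "card E \<le> card (peeled E) + 22 * (card V)\<^sup>2"
proof -
  have t1: "A \<subseteq> V \<and> card A = 3" if "A \<in> core E" for A
    using that core_sub triple by blast
  have t2: "A \<subseteq> V \<and> card A = 3" if "A \<in> core (core E)" for A
    using that core_sub triple by blast
  have "card (core (core E) - peeled E) \<le> 10 * (card V)\<^sup>2"
  proof (rule card_triples_le[OF finV])
    fix A assume A: "A \<in> core (core E) - peeled E"
    then obtain x y z where xyz: "A = {x, y, z}" "z \<in> small_angle_apexes (core (core E)) x y"
      by (auto simp: peeled_def)
    moreover have "x \<in> V" "y \<in> V" using t2[of A] A xyz by auto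
    ultimately show "\<exists>x\<in>V. \<exists>y\<in>V. \<exists>z\<in>small_angle_apexes (core (core E)) x y. A = {x, y, z}" by blast
  qed (rule small_angle_apexes_bound)
  moreover have "card (core (core E)) \<le> card (peeled E) + card (core (core E) - peeled E)"
    using card_Un_le[of "peeled E" "core (core E) - peeled E"] core_sub(4) by (simp add: Un_absorb1)
  moreover have "card E \<le> card (core E) + 6 * (card V)\<^sup>2" by (rule card_core[OF finV triple])
  moreover have "card (core E) \<le> card (core (core E)) + 6 * (card V)\<^sup>2" by (rule card_core[OF finV t1])
  ultimately show ?thesis by linarith
qed

text \<open>
  Let \<open>z1\<close> and \<open>z2\<close> be the apexes outside \<open>C\<close> seen under the smallest angles from \<open>x\<close> and from \<open>y\<close>. The
  segments \<open>x z1\<close> and \<open>y z2\<close> meet in a point of the triangle \<open>x y d\<close>, hence of the triangle \<open>C\<close>.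
  If \<open>z1 = z2\<close>, this vertex itself lies in another triangle over \<open>xy\<close>.
\<close>

lemma no_nested_oriented:
  assumes T: "{x, y, d} \<in> peeled E" and C: "C \<in> E" "d \<in> C" "x \<notin> C" "y \<notin> C"
    and sub: "convex hull {x, y, d} \<subseteq> convex hull C" and pos: "det2 x y d > 0"
  shows False
proof -
  define a where "a z = cot_at x y z" for z
  define b where "b z = - cot_at y x z" for z
  define Z where "Z = {z. {x, y, z} \<in> core (core E) \<and> det2 x y z > 0}"
  have C3: "finite C" "card C = 3" using triple[OF C(1)] by (auto intro: card_ge_0_finite)
  have ZE: "{x, y, z} \<in> core (core E)" "{x, y, z} \<in> E" "det2 x y z > 0" if "z \<in> Z" for z
    using that core_sub by (auto simp: Z_def)
  have fZ: "finite Z"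
    by (rule finite_subset[OF _ finite_apexes[of x y]]) (use ZE in auto)
  have ap: "apex x y (a z) (b z) = z" "a z + b z > 0" if "det2 x y z > 0" for z
    using that apex_cot[of x y z] cot_sum_pos[of x y z] by (auto simp: a_def b_def)
  have dZ: "d \<in> Z" using T core_sub(4) pos by (auto simp: Z_def)
  have nd: "d \<notin> small_angle_apexes (core (core E)) x y" using T unfolding peeled_def by blast
  have ra: "card {r \<in> Z. a d < a r} \<ge> 5" and rb: "card {r \<in> Z. b d < b r} \<ge> 5"
    using nd dZ unfolding small_angle_apexes_def Let_def Z_def[symmetric] a_def b_def
    by (auto simp: not_less)
  have avoidZ: "\<exists>r\<in>Z. P r \<and> r \<notin> F" if "card {r \<in> Z. P r} \<ge> 5" "card F \<le> 4" "finite F" for P F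
  proof (rule ccontr)
    assume "\<not> ?thesis"
    hence "{r \<in> Z. P r} \<subseteq> F" by blast
    from card_mono[OF that(3) this] show False using that by simp
  qed
  obtain ra' where ra': "ra' \<in> Z" "a d < a ra'" "ra' \<notin> C" using avoidZ[OF ra, of C] C3 by auto
  obtain rb' where rb': "rb' \<in> Z" "b d < b rb'" "rb' \<notin> C" using avoidZ[OF rb, of C] C3 by auto
  have ne: "Z - C \<noteq> {}" "finite (Z - C)" using ra' fZ by auto
  obtain z1 where z1: "z1 \<in> Z - C" "\<And>r. r \<in> Z - C \<Longrightarrow> a r \<le> a z1"
    using ex_max_on[OF ne(2,1), of a] by blast
  obtain z2 where z2: "z2 \<in> Z - C" "\<And>r. r \<in> Z - C \<Longrightarrow> b r \<le> b z2"
    using ex_max_on[OF ne(2,1), of b] by blast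
  \<comment> \<open>Combining the two best coordinates dominates \<open>d\<close> and every apex
    outside \<open>C\<close>, which places \<open>t\<close> in all their triangles over
    \<open>xy\<close>.\<close>
  define t where "t = apex x y (a z1) (b z2)"
  have ab: "a d \<le> a z1" "b d \<le> b z2" using z1(2)[of ra'] z2(2)[of rb'] ra' rb' by auto
  have "t \<in> convex hull {x, y, d}"
    using apex_in_triangle[OF ap(2)[OF pos] ab, of x y] ap(1)[OF pos] by (simp add: t_def)
  hence tC: "t \<in> convex hull C" using sub by blast
  have Z12: "z1 \<in> Z" "z2 \<in> Z" "z1 \<notin> C" "z2 \<notin> C" using z1 z2 by auto
  note e1 = ZE[OF Z12(1)] and e2 = ZE[OF Z12(2)]
  note d1 = triple_distinct[OF e1(2)] and d2 = triple_distinct[OF e2(2)]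
  show False
  proof (cases "z1 = z2")
    case False
    have "t \<in> convex hull {x, z1}"
      using apex_on_side_left[of "a z1" "b z1" "b z2" x y] ap[OF e1(3)] z2(2)[OF z1(1)] by (simp add: t_def)
    moreover have "t \<in> convex hull {y, z2}"
      using apex_on_side_right[of "a z2" "b z2" "a z1" x y] ap[OF e2(3)] z1(2)[OF z2(1)] by (simp add: t_def)
    moreover have "heavy E x z1" "heavy E y z2"
      using e1(1) e2(1) core_sub(3) d1 d2 heavy_core[of x z1 y] heavy_core[of y z2 x]
      by (auto simp: insert_commute)
    ultimately show False
      using crossing_pairs_avoid[of x z1 y z2 C t] False d1 d2 C Z12 tC by auto
  next
    case True
    have tz: "t = z1" using ap(1)[OF e1(3)] True by (simp add: t_def)
    have "card (insert z1 C) \<le> 4" using C3 by (simp add: card_insert_if)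
    then obtain z' where z': "z' \<in> Z" "z' \<notin> insert z1 C"
      using avoidZ[OF ra, of "insert z1 C"] C3 by auto
    note e' = ZE[OF z'(1)]
    have "z1 \<in> convex hull {x, y, z'}"
      using apex_in_triangle[of "a z'" "b z'" "a z1" "b z1" x y] ap[OF e'(3)] ap[OF e1(3)]
        z1(2)[of z'] z2(2)[of z'] z' True by auto
    have F: "card ({x, y, z'} \<union> C) \<le> 6" "finite ({x, y, z'} \<union> C)"
      using card_Un_le[of "{x, y, z'}" C] C3 triple[OF e'(2)] by auto
    \<comment> \<open>A triangle at \<open>z1\<close> avoiding \<open>x\<close> and \<open>y\<close>
      takes two extensions: from \<open>x z1\<close> into \<open>core E\<close>, then from
      \<open>z1 q\<close> into \<open>E\<close>. Hence the double \<open>core\<close>.\<close>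
    have "heavy (core E) x z1"
      using e1(1) d1 heavy_core[of x z1 y] by (auto simp: insert_commute)
    then obtain q where q: "{x, z1, q} \<in> core E" "q \<notin> {x, y, z'} \<union> C"
      using heavy_extend F by metis
    have "q \<noteq> z1" using triple_distinct[of x z1 q] q core_sub(1) by auto
    hence "heavy E z1 q"
      using q(1) heavy_core[of z1 q x] by (auto simp: insert_commute)
    then obtain q' where q': "{z1, q, q'} \<in> E" "q' \<notin> {x, y, z'} \<union> C"
      using heavy_extend F by metis
    have "z1 \<in> convex hull {z1, q, q'}" by (simp add: hull_inc)
    moreover have "{z1, q, q'} \<inter> {x, y, z'} = {}" "{z1, q, q'} \<inter> C = {}" "{x, y, z'} \<inter> C = {}"
      using q q' z' Z12 d1 C by auto
    ultimately show False
      using no_crossing[OF q'(1) e'(2) C(1)] \<open>z1 \<in> convex hull {x, y, z'}\<close> tC tz by blast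
  qed
qed

lemma no_nested:
  assumes T: "{x, y, d} \<in> peeled E" and C: "C \<in> E" "d \<in> C" "x \<notin> C" "y \<notin> C"
    and sub: "convex hull {x, y, d} \<subseteq> convex hull C"
  shows False
proof -
  have "{x, y, d} \<in> E" using T core_sub by blast
  note d = triple_distinct[OF this]
  have "det2 x y d \<noteq> 0" using det2_nonzero[of x y d] d by blast
  hence "det2 x y d > 0 \<or> det2 y x d > 0" using det2_swap[of y x d] by linarith
  thus False
    using no_nested_oriented[OF T C sub] no_nested_oriented[of y x d C] T C sub
    by (auto simp: insert_commute)
qed

end

section \<open>The link of a vertex\<close>

definition tilt :: "real \<Rightarrow> real^2 \<Rightarrow> real" where
  "tilt e p = p$1 + e * p$2"

text \<open>Only the finitely many values of \<open>e\<close> that put two points of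
  \<open>V\<close> at the same level must be avoided.\<close>

lemma tilt_inj_exists:
  assumes "finite V"
  shows "\<exists>e. inj_on (tilt e) V"
proof -
  define B where "B = (\<lambda>(p, q). - (p$1 - q$1) / (p$2 - q$2)) ` (V \<times> V)"
  have "finite B" using assms by (simp add: B_def)
  then obtain e where e: "e \<notin> B" using ex_new_if_finite[OF infinite_UNIV_char_0] by blast
  have "p = q" if pq: "p \<in> V" "q \<in> V" "tilt e p = tilt e q" for p q
  proof -
    have eq: "p$1 - q$1 = - (e * (p$2 - q$2))" using pq(3) by (simp add: tilt_def algebra_simps)
    have "p$2 = q$2"
    proof (rule ccontr)
      assume "p$2 \<noteq> q$2"
      hence "e = - (p$1 - q$1) / (p$2 - q$2)" using eq by (simp add: eq)
      thus False using e pq by (force simp: B_def)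
    qed
    thus ?thesis using eq by (simp add: vec_eq_iff forall_2)
  qed
  thus ?thesis by (intro exI[of _ e]) (simp add: inj_on_def)
qed

text \<open>
  The projective coordinates \<open>(Y/X, -1/X)\<close> relative to \<open>d\<close>: rays from \<open>d\<close> become vertical lines, with \<open>d\<close>
  at vertical minus infinity.
\<close>

definition proj_u :: "real \<Rightarrow> real^2 \<Rightarrow> real^2 \<Rightarrow> real" where
  "proj_u e d p = (p$2 - d$2) / (tilt e p - tilt e d)"

definition proj_v :: "real \<Rightarrow> real^2 \<Rightarrow> real^2 \<Rightarrow> real" where
  "proj_v e d p = - 1 / (tilt e p - tilt e d)"

text \<open>The direction of the ray from \<open>d\<close> on which \<open>proj_u\<close> equals
  \<open>t\<close>, scaled to have \<open>tilt\<close> 1.\<close>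

definition ray_dir :: "real \<Rightarrow> real \<Rightarrow> real^2" where
  "ray_dir e t = vector [1 - e * t, t]"

definition unproj :: "real \<Rightarrow> real^2 \<Rightarrow> real \<Rightarrow> real \<Rightarrow> real^2" where
  "unproj e d t h = d + (- 1 / h) *\<^sub>R ray_dir e t"

lemma unproj_proj:
  assumes "tilt e d < tilt e p"
  shows "unproj e d (proj_u e d p) (proj_v e d p) = p"
proof -
  define X where "X = tilt e p - tilt e d"
  have X: "X > 0" "X = p$1 - d$1 + e * (p$2 - d$2)"
    using assms by (auto simp: X_def tilt_def algebra_simps)
  have u: "proj_u e d p = (p$2 - d$2) / X" and v: "- 1 / proj_v e d p = X"
    using X by (auto simp: proj_u_def proj_v_def X_def)
  have "X * (1 - e * (Y / X)) = X - e * Y" for Y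
    using X(1) by (simp add: field_simps)
  from this[of "p$2 - d$2"] have "X * (1 - e * ((p$2 - d$2) / X)) = p$1 - d$1" using X(2) by simp
  thus ?thesis
    unfolding unproj_def v u ray_dir_def using X(1) by (simp add: vec_eq_iff forall_2)
qed

lemma ray_dir_affine: "ray_dir e ((1 - l) * s + l * t) = (1 - l) *\<^sub>R ray_dir e s + l *\<^sub>R ray_dir e t"
  by (simp add: ray_dir_def vec_eq_iff forall_2 algebra_simps)

lemma proj_v_neg: "tilt e d < tilt e p \<Longrightarrow> proj_v e d p < 0"
  by (simp add: proj_v_def)

context
  fixes e :: real and d x y :: "real^2" and t h :: real
  assumes x: "tilt e d < tilt e x" and y: "tilt e d < tilt e y"
    and t: "proj_u e d x < proj_u e d y" "proj_u e d x \<le> t" "t \<le> proj_u e d y"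
    and h: "h \<le> height (proj_u e d) (proj_v e d) x y t"
begin

text \<open>Descending a vertical line means approaching \<open>d\<close>: if the edge has height
  \<open>H < 0\<close> over \<open>t\<close>, the coefficients at height \<open>h \<le> H\<close>
  sum to \<open>H / h \<le> 1\<close>.\<close>

lemma unproj_combination:
  obtains \<alpha> \<beta> where "0 \<le> \<alpha>" "0 \<le> \<beta>" "\<alpha> + \<beta> \<le> 1"
    "h = height (proj_u e d) (proj_v e d) x y t \<Longrightarrow> \<alpha> + \<beta> = 1"
    "unproj e d t h = d + \<alpha> *\<^sub>R (x - d) + \<beta> *\<^sub>R (y - d)"
proof -
  define l where "l = (t - proj_u e d x) / (proj_u e d y - proj_u e d x)"
  have l: "0 \<le> l" "l \<le> 1" using t by (auto simp: l_def divide_simps)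
  have tl: "t = (1 - l) * proj_u e d x + l * proj_u e d y"
  proof -
    have "l * (proj_u e d y - proj_u e d x) = t - proj_u e d x" using t(1) by (simp add: l_def)
    thus ?thesis by (simp add: algebra_simps)
  qed
  have vx: "proj_v e d x < 0" and vy: "proj_v e d y < 0" using proj_v_neg x y by auto
  define H where "H = height (proj_u e d) (proj_v e d) x y t"
  have H: "H = (1 - l) * proj_v e d x + l * proj_v e d y"
    by (simp add: H_def height_def slope_def l_def algebra_simps diff_divide_distrib)
  have "H \<le> (1 - l) * max (proj_v e d x) (proj_v e d y) + l * max (proj_v e d x) (proj_v e d y)"
    unfolding H using l by (intro add_mono mult_left_mono) auto
  also have "\<dots> = max (proj_v e d x) (proj_v e d y)" by (simp add: algebra_simps)
  also have "\<dots> < 0" using vx vy by simp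
  finally have Hneg: "H < 0" .
  hence hneg: "h < 0" using h by (simp add: H_def)
  define \<alpha> where "\<alpha> = (1 - l) * proj_v e d x / h"
  define \<beta> where "\<beta> = l * proj_v e d y / h"
  have xd: "x - d = (- 1 / proj_v e d x) *\<^sub>R ray_dir e (proj_u e d x)"
    using unproj_proj[OF x] by (metis add_diff_cancel_left' unproj_def)
  have yd: "y - d = (- 1 / proj_v e d y) *\<^sub>R ray_dir e (proj_u e d y)"
    using unproj_proj[OF y] by (metis add_diff_cancel_left' unproj_def)
  have "\<alpha> *\<^sub>R (x - d) = ((- 1 / h) * (1 - l)) *\<^sub>R ray_dir e (proj_u e d x)"
    unfolding xd using vx by (simp add: \<alpha>_def)
  moreover have "\<beta> *\<^sub>R (y - d) = ((- 1 / h) * l) *\<^sub>R ray_dir e (proj_u e d y)"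
    unfolding yd using vy by (simp add: \<beta>_def)
  moreover have "(- 1 / h) *\<^sub>R ray_dir e t
      = ((- 1 / h) * (1 - l)) *\<^sub>R ray_dir e (proj_u e d x) + ((- 1 / h) * l) *\<^sub>R ray_dir e (proj_u e d y)"
    unfolding tl ray_dir_affine by (simp only: scaleR_add_right scaleR_scaleR)
  ultimately have "unproj e d t h = d + \<alpha> *\<^sub>R (x - d) + \<beta> *\<^sub>R (y - d)"
    by (simp add: unproj_def)
  moreover have "0 \<le> \<alpha>" "0 \<le> \<beta>"
    using l vx vy hneg by (auto simp: \<alpha>_def \<beta>_def intro!: divide_nonpos_nonpos mult_nonneg_nonpos)
  moreover have sum: "\<alpha> + \<beta> = H / h" by (simp add: \<alpha>_def \<beta>_def H add_divide_distrib)
  moreover have "H / h \<le> 1" using h hneg by (simp add: H_def neg_divide_le_eq)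
  moreover have "H / h = 1" if "h = H" using that hneg by simp
  ultimately show thesis using that[of \<alpha> \<beta>] by (simp add: H_def)
qed

lemma unproj_in_triangle: "unproj e d t h \<in> convex hull {x, y, d}"
proof -
  obtain \<alpha> \<beta> where ab: "0 \<le> \<alpha>" "0 \<le> \<beta>" "\<alpha> + \<beta> \<le> 1"
    "unproj e d t h = d + \<alpha> *\<^sub>R (x - d) + \<beta> *\<^sub>R (y - d)" using unproj_combination by metis
  have "unproj e d t h = \<alpha> *\<^sub>R x + \<beta> *\<^sub>R y + (1 - \<alpha> - \<beta>) *\<^sub>R d"
    unfolding ab(4) by (simp add: algebra_simps)
  thus ?thesis
    unfolding convex_hull_3 using ab(1-3)
    by (intro CollectI exI[of _ \<alpha>] exI[of _ \<beta>] exI[of _ "1 - \<alpha> - \<beta>"]) auto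
qed

lemma unproj_in_segment:
  assumes "h = height (proj_u e d) (proj_v e d) x y t"
  shows "unproj e d t h \<in> convex hull {x, y}"
proof -
  obtain \<alpha> \<beta> where ab: "0 \<le> \<alpha>" "0 \<le> \<beta>" "\<alpha> + \<beta> = 1"
    "unproj e d t h = d + \<alpha> *\<^sub>R (x - d) + \<beta> *\<^sub>R (y - d)" using unproj_combination assms by metis
  have "unproj e d t h = \<alpha> *\<^sub>R x + \<beta> *\<^sub>R y + (1 - (\<alpha> + \<beta>)) *\<^sub>R d"
    unfolding ab(4) by (simp add: algebra_simps)
  hence "unproj e d t h = \<alpha> *\<^sub>R x + \<beta> *\<^sub>R y" using ab(3) by simp
  thus ?thesis
    unfolding convex_hull_2 using ab(1-3) by blast
qed

end

section \<open>Counting the remaining triples through links\<close>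

context crossing_free
begin

text \<open>All link triangles share \<open>d\<close>, so a crossing of two edges becomes a crossing
  of disjoint triangles only after extending both edges elsewhere; the third triangle keeps
  \<open>d\<close>. For nested edges, the smaller triangle has all its vertices in the larger one
  and \<open>no_nested\<close> applies.\<close>

lemma link_graph_peeled:
  fixes e :: real
  assumes d: "d \<in> V"
  defines "N \<equiv> {p \<in> V. tilt e d < tilt e p}"
  shows "link_graph (proj_u e d) (proj_v e d) N
           {(x, y). {x, y, d} \<in> peeled E \<and> x \<in> N \<and> y \<in> N \<and> proj_u e d x < proj_u e d y}"
    (is "link_graph ?u ?v N ?L")
proof
  show "finite N" using finV by (simp add: N_def)
  show "inj_on ?u N"
  proof (rule inj_onI, rule ccontr)
    fix p q assume pq: "p \<in> N" "q \<in> N" "?u p = ?u q" "p \<noteq> q"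
    have N: "tilt e d < tilt e p" "tilt e d < tilt e q" using pq by (auto simp: N_def)
    note v = proj_v_neg[OF N(1)] proj_v_neg[OF N(2)]
    have "p - d = (- 1 / ?v p) *\<^sub>R ray_dir e (?u p)" "q - d = (- 1 / ?v q) *\<^sub>R ray_dir e (?u p)"
      using unproj_proj[OF N(1)] unproj_proj[OF N(2)] pq(3) by (metis add_diff_cancel_left' unproj_def)+
    hence "p - d = (?v q / ?v p) *\<^sub>R (q - d)" using v by simp
    hence "collinear {d, p, q}" by (rule collinear_scaled)
    thus False using not_collinear[of d p q] pq d by (auto simp: N_def)
  qed
  fix x y assume "(x, y) \<in> ?L"
  thus "x \<in> N \<and> y \<in> N \<and> ?u x < ?u y" by simp
next
  fix x1 y1 x2 y2 x3 y3 and t :: real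
  assume L: "(x1, y1) \<in> ?L" "(x2, y2) \<in> ?L" "(x3, y3) \<in> ?L"
    and dist: "distinct [x1, y1, x2, y2, x3, y3]"
    and t: "?u x1 \<le> t" "t \<le> ?u y1" "?u x2 \<le> t" "t \<le> ?u y2" "?u x3 \<le> t" "t \<le> ?u y3"
    and eq: "height ?u ?v x1 y1 t = height ?u ?v x2 y2 t"
    and le: "height ?u ?v x1 y1 t \<le> height ?u ?v x3 y3 t"
  have N: "tilt e d < tilt e x" "tilt e d < tilt e y" "?u x < ?u y" "{x, y, d} \<in> core E" "{x, y, d} \<in> E"
    if "(x, y) \<in> ?L" for x y
    using that core_sub by (auto simp: N_def)
  define P where "P = unproj e d t (height ?u ?v x1 y1 t)"
  have "P \<in> convex hull {x1, y1}"
    unfolding P_def by (rule unproj_in_segment) (use N[OF L(1)] t in simp_all)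
  moreover have "P \<in> convex hull {x2, y2}"
    unfolding P_def eq by (rule unproj_in_segment) (use N[OF L(2)] t in simp_all)
  moreover have "P \<in> convex hull {x3, y3, d}"
    unfolding P_def by (rule unproj_in_triangle) (use N[OF L(3)] t le in simp_all)
  moreover have "heavy E x1 y1" "heavy E x2 y2"
    using heavy_core[OF N(4)[OF L(1)]] heavy_core[OF N(4)[OF L(2)]] dist by auto
  moreover have "x1 \<noteq> d" "y1 \<noteq> d" "x2 \<noteq> d" "y2 \<noteq> d"
    using N(1,2)[OF L(1)] N(1,2)[OF L(2)] by auto
  ultimately show False
    using crossing_pairs_avoid[of x1 y1 x2 y2 "{x3, y3, d}" P] N(5)[OF L(3)] dist by simp
next
  fix x y x' y'
  assume L: "(x, y) \<in> ?L" "(x', y') \<in> ?L" and dist: "distinct [x, y, x', y']"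
    and u: "?u x' \<le> ?u x" "?u y \<le> ?u y'"
    and v: "?v x \<le> height ?u ?v x' y' (?u x)" "?v y \<le> height ?u ?v x' y' (?u y)"
  have N: "tilt e d < tilt e x" "tilt e d < tilt e y" "?u x < ?u y" "{x, y, d} \<in> peeled E" "{x, y, d} \<in> E"
    if "(x, y) \<in> ?L" for x y
    using that core_sub by (auto simp: N_def)
  have "unproj e d (?u x) (?v x) \<in> convex hull {x', y', d}"
    by (rule unproj_in_triangle) (use N[OF L(1)] N[OF L(2)] u v in simp_all)
  moreover have "unproj e d (?u y) (?v y) \<in> convex hull {x', y', d}"
    by (rule unproj_in_triangle) (use N[OF L(1)] N[OF L(2)] u v in simp_all)
  moreover have "d \<in> convex hull {x', y', d}" by (simp add: hull_inc)
  ultimately have "{x, y, d} \<subseteq> convex hull {x', y', d}"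
    using unproj_proj N(1,2)[OF L(1)] by simp
  hence "convex hull {x, y, d} \<subseteq> convex hull {x', y', d}"
    by (rule hull_minimal) (rule convex_convex_hull)
  thus False
    using no_nested[OF N(4)[OF L(1)] N(5)[OF L(2)]] dist N(1,2)[OF L(1)] by auto
qed

text \<open>Each triple is charged to its lowest vertex, where its other two vertices form an edge
  of the link graph.\<close>

lemma card_peeled_le: "card (peeled E) \<le> 44 * (card V)\<^sup>2"
proof -
  obtain e where e: "inj_on (tilt e) V" using tilt_inj_exists[OF finV] by blast
  have P: "A \<subseteq> V \<and> card A = 3" if "A \<in> peeled E" for A using that core_sub triple by blast
  have "\<exists>d\<in>A. \<forall>p\<in>A. tilt e d \<le> tilt e p" if A: "A \<in> peeled E" for A
  proof -
    have "finite A" "A \<noteq> {}" using P[OF A] by (auto intro: card_ge_0_finite)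
    from ex_max_on[OF this, of "\<lambda>p. - tilt e p"] show ?thesis by simp
  qed
  then obtain g where g: "\<And>A. A \<in> peeled E \<Longrightarrow> g A \<in> A \<and> (\<forall>p\<in>A. tilt e (g A) \<le> tilt e p)" by metis
  have "card (peeled E) \<le> (44 * card V) * card V"
  proof (rule card_le_fibers[where g = g])
    have "peeled E \<subseteq> Pow V" using P by blast
    thus "finite (peeled E)" using finV by (simp add: finite_subset)
    show "g ` peeled E \<subseteq> V" using g P by blast
    fix d assume d: "d \<in> V"
    define N where "N = {p \<in> V. tilt e d < tilt e p}"
    define L where "L = {(x, y). {x, y, d} \<in> peeled E \<and> x \<in> N \<and> y \<in> N \<and> proj_u e d x < proj_u e d y}"
    interpret link_graph "proj_u e d" "proj_v e d" N L
      unfolding L_def N_def by (rule link_graph_peeled[OF d])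
    have "{A \<in> peeled E. g A = d} \<subseteq> (\<lambda>(x, y). {x, y, d}) ` L"
    proof
      fix A assume "A \<in> {A \<in> peeled E. g A = d}"
      hence A: "A \<in> peeled E" "d \<in> A" "\<forall>p\<in>A. tilt e d \<le> tilt e p" using g by auto
      have "card (A - {d}) = 2" using P[OF A(1)] A(2) by simp
      then obtain x y where xy: "A - {d} = {x, y}" "x \<noteq> y" by (auto simp: card_2_iff)
      have Axy: "A = {x, y, d}" using xy A(2) by auto
      have xd: "x \<noteq> d" "y \<noteq> d" using xy by auto
      have V: "x \<in> V" "y \<in> V" using P[OF A(1)] Axy by auto
      have "tilt e x \<noteq> tilt e d" "tilt e y \<noteq> tilt e d" using e V d xd by (auto simp: inj_on_def)
      moreover have "tilt e d \<le> tilt e x" "tilt e d \<le> tilt e y" using A(3) Axy by auto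
      ultimately have N: "x \<in> N" "y \<in> N" using V by (auto simp: N_def)
      hence "proj_u e d x \<noteq> proj_u e d y" using inj xy(2) by (auto simp: inj_on_def)
      hence "(x, y) \<in> L \<or> (y, x) \<in> L"
        using A(1) N unfolding L_def Axy by (auto simp: insert_commute)
      thus "A \<in> (\<lambda>(x, y). {x, y, d}) ` L"
        using Axy by (force simp: insert_commute)
    qed
    hence "card {A \<in> peeled E. g A = d} \<le> card ((\<lambda>(x, y). {x, y, d}) ` L)"
      by (intro card_mono) auto
    also have "\<dots> \<le> card L" by (rule card_image_le) simp
    also have "\<dots> \<le> 44 * card N" by (rule card_edges_le)
    also have "\<dots> \<le> 44 * card V" using finV by (simp add: N_def card_mono)
    finally show "card {A \<in> peeled E. g A = d} \<le> 44 * card V" .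
  qed (rule finV)
  thus ?thesis by (simp add: power2_eq_square)
qed

lemma card_crossing_free: "card E \<le> 66 * (card V)\<^sup>2"
  using card_peeled card_peeled_le by linarith

end

section \<open>The extremal function\<close>

lemma upper_bound:
  assumes H: "geometric_3_hypergraph V E" and no: "\<not> has_strongly_crossing_edges 3 E"
  shows "card E \<le> 66 * (card V)\<^sup>2"
proof -
  \<comment> \<open>The argument concerns vertex sets; recovering them as extreme points keeps
    disjoint triples distinct as triangles.\<close>
  define T where "T = {A. A \<subseteq> V \<and> card A = 3 \<and> convex hull A \<in> E}"
  have V: "finite V" "general_position V" "E \<subseteq> {convex hull A | A. A \<subseteq> V \<and> card A = 3}"
    using H by (auto simp: geometric_3_hypergraph_def)
  have vert: "triangle_vertices (convex hull A) = A" if "A \<in> T" for A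
    using triangle_vertices_convex_hull[OF V(2)] that by (simp add: T_def)
  interpret crossing_free V T
  proof
    fix A assume "A \<in> T" thus "A \<subseteq> V \<and> card A = 3" by (simp add: T_def)
  next
    fix A B C P
    assume T: "A \<in> T" "B \<in> T" "C \<in> T" and dj: "A \<inter> B = {}" "A \<inter> C = {}" "B \<inter> C = {}"
      and P: "P \<in> convex hull A" "P \<in> convex hull B" "P \<in> convex hull C"
    have "A \<noteq> {}" "B \<noteq> {}" using T by (auto simp: T_def)
    hence "A \<noteq> B" "A \<noteq> C" "B \<noteq> C" using dj by auto
    hence ne: "convex hull A \<noteq> convex hull B" "convex hull A \<noteq> convex hull C" "convex hull B \<noteq> convex hull C"
      using vert T by metis+
    define F where "F = {convex hull A, convex hull B, convex hull C}"
    have "F \<subseteq> E" using T by (auto simp: F_def T_def)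
    moreover have "card F = 3" using ne by (simp add: F_def)
    moreover have "pairwise (\<lambda>T T'. triangle_vertices T \<inter> triangle_vertices T' = {}) F"
      using dj vert T by (auto simp: F_def pairwise_def)
    moreover have "P \<in> \<Inter>F" using P by (simp add: F_def)
    ultimately have "has_strongly_crossing_edges 3 E"
      unfolding has_strongly_crossing_edges_def by blast
    thus False using no by blast
  qed (use V in simp_all)
  have "E \<subseteq> (\<lambda>A. convex hull A) ` T" using V(3) by (auto simp: T_def)
  moreover have "finite T" using V(1) by (simp add: T_def)
  ultimately have "card E \<le> card T"
    by (meson card_image_le card_mono finite_imageI order_trans)
  also have "\<dots> \<le> 66 * (card V)\<^sup>2" by (rule card_crossing_free)
  finally show ?thesis .
qed

lemma star_not_strongly_crossing:
  assumes "\<And>T. T \<in> E \<Longrightarrow> x \<in> triangle_vertices T" "2 \<le> k"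
  shows "\<not> has_strongly_crossing_edges k E"
proof
  assume "has_strongly_crossing_edges k E"
  then obtain F where F: "F \<subseteq> E" "card F = k" "pairwise (\<lambda>T T'. triangle_vertices T \<inter> triangle_vertices T' = {}) F"
    by (auto simp: has_strongly_crossing_edges_def)
  obtain S where S: "S \<in> F" using card_ge_2_other[of F undefined] F(2) assms(2) by auto
  obtain S' where S': "S' \<in> F" "S' \<noteq> S" using card_ge_2_other[of F S] F(2) assms(2) by auto
  have "triangle_vertices S \<inter> triangle_vertices S' = {}"
    using F(3) S S' by (auto simp: pairwise_def)
  thus False using assms(1) S S' F(1) by blast
qed

text \<open>The edges are all triangles at one vertex. Distinct opposite pairs give distinct
  triangles because the vertices can be recovered.\<close>

lemma lower_bound:
  assumes "2 \<le> k" "0 < n"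
  shows "\<exists>V E. geometric_3_hypergraph V E \<and> card V = n \<and> \<not> has_strongly_crossing_edges k E
           \<and> card E = (n - 1) choose 2"
proof -
  obtain V where V: "finite V" "card V = n" "general_position V"
    using general_position_exists by blast
  then obtain x where x: "x \<in> V" using assms(2) by fastforce
  define S where "S = {B. B \<subseteq> V - {x} \<and> card B = 2}"
  define E where "E = (\<lambda>B. convex hull (insert x B)) ` S"
  have ins: "insert x B \<subseteq> V" "card (insert x B) = 3" "x \<notin> B" if "B \<in> S" for B
  proof -
    have "finite B" using that V(1) by (auto simp: S_def intro: finite_subset)
    thus "insert x B \<subseteq> V" "card (insert x B) = 3" "x \<notin> B"
      using that x by (auto simp: S_def card_insert_if)
  qed
  have vert: "triangle_vertices (convex hull (insert x B)) = insert x B" if "B \<in> S" for B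
    using triangle_vertices_convex_hull[OF V(3)] ins[OF that] by blast
  have "inj_on (\<lambda>B. convex hull (insert x B)) S"
  proof (rule inj_onI)
    fix B B' assume B: "B \<in> S" "B' \<in> S" "convex hull (insert x B) = convex hull (insert x B')"
    hence "insert x B = insert x B'" using vert by metis
    thus "B = B'" using ins(3) B(1,2) by (metis Diff_insert_absorb)
  qed
  hence "card E = card S" by (simp add: E_def card_image)
  also have "\<dots> = (n - 1) choose 2"
    using n_subsets[of "V - {x}" 2] V x by (simp add: S_def)
  finally have "card E = (n - 1) choose 2" .
  moreover have "geometric_3_hypergraph V E"
    unfolding geometric_3_hypergraph_def E_def using V ins by blast
  moreover have "\<not> has_strongly_crossing_edges k E"
    by (rule star_not_strongly_crossing[OF _ assms(1)]) (use vert in \<open>auto simp: E_def\<close>)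
  ultimately show ?thesis using V(2) by blast
qed

theorem theorem1p2:
  shows "\<exists>c > (0::real). \<exists>C > (0::real). \<exists>n0 :: nat. \<forall>n \<ge> n0.
           c * (real n)\<^sup>2 \<le> real (ex2_SC 3 n) \<and> real (ex2_SC 3 n) \<le> C * (real n)\<^sup>2"
proof (rule exI[of _ "1/8"], intro conjI, simp, rule exI[of _ 66], intro conjI, simp,
    rule exI[of _ 4], intro allI impI conjI)
  fix n :: nat assume n: "4 \<le> n"
  obtain V E where VE: "geometric_3_hypergraph V E" "card V = n" "\<not> has_strongly_crossing_edges 3 E"
    "card E = (n - 1) choose 2"
    using lower_bound[of 3 n] n by auto
  have "(n - 1) choose 2 \<le> ex2_SC 3 n"
    unfolding ex2_SC_def VE(4)[symmetric] using VE(1-3)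
    by (intro Max_ge[OF finite_SC_free_sizes]) (unfold SC_free_sizes_def, blast)
  moreover have "real ((n - 1) choose 2) = (real n - 1) * (real n - 2) / 2"
    using n by (simp add: choose_two real_of_nat_div of_nat_diff)
  moreover have "1 / 8 * (real n)\<^sup>2 \<le> (real n - 1) * (real n - 2) / 2"
  proof -
    \<comment> \<open>After multiplication by 8 the claim reads
      \<open>3 * n * (n - 4) + 8 \<ge> 0\<close>, which explains the starting value 4.\<close>
    have "(real n - 4) * (3 * real n) \<ge> 0" using n by simp
    thus ?thesis by (simp add: power2_eq_square algebra_simps)
  qed
  ultimately show "1 / 8 * (real n)\<^sup>2 \<le> real (ex2_SC 3 n)" by linarith
  have "ex2_SC 3 n \<in> SC_free_sizes 3 n"
    unfolding ex2_SC_def by (intro Max_in finite_SC_free_sizes SC_free_sizes_nonempty) simp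
  hence "ex2_SC 3 n \<le> 66 * n\<^sup>2"
    using upper_bound by (auto simp: SC_free_sizes_def)
  hence "real (ex2_SC 3 n) \<le> real (66 * n\<^sup>2)" by (rule of_nat_mono)
  thus "real (ex2_SC 3 n) \<le> 66 * (real n)\<^sup>2" by simp
qed

end
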